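(* Let $f:\mathbb{R}^d\to\mathbb{R}$ be convex, differentiable, $L$-smooth, and minimized at $x_*\in\mathbb{R}^d$. Let $\xi$ be a random variable of law $\mathcal{P}$ on a space $\Xi$, and let $\nabla f(x,\xi)$ be stochastic gradients that are unbiased, $\mathbb{E}_\xi\nabla f(x,\xi)=\nabla f(x)$ for all $x\in\mathbb{R}^d$, and have uniformly bounded variance, $\mathbb{E}_\xi\|\nabla f(x,\xi)-\nabla f(x)\|^2\le\sigma^2$ for all $x\in\mathbb{R}^d$, for some $\sigma^2\ge0$. Let $(x_t,z_t)_{t\ge0}$ be the càdlàg process with initial values $x_0,z_0\in\mathbb{R}^d$ satisfying $$\mathrm{d}x_t=\eta_t(z_t-x_t)\,\mathrm{d}t-\gamma_t\int_\Xi\nabla f(x_t,\xi)\,\mathrm{d}N(t,\xi),\qquad \mathrm{d}z_t=\eta'_t(x_t-z_t)\,\mathrm{d}t-\gamma'_t\int_\Xi\nabla f(x_t,\xi)\,\mathrm{d}N(t,\xi),$$ where $N$ is a Poisson point measure on $\mathbb{R}_{\ge0}\times\Xi$ with intensity $\mathrm{d}t\otimes\mathcal{P}$. Then: 1. For $\eta_t=\frac2t$, $\eta'_t=0$, $\gamma_t=\frac1L$, $\gamma'_t=\frac t{2L}$, $$\mathbb{E}f(x_t)-f(x_* )\le\frac{2L\|z_0-x_*\|^2}{t^2}+\sigma^2\frac{t}{3L}.$$ 2. Assume further that $f$ is $\mu$-strongly convex, $\mu>0$. For $\eta_t=\eta'_t\equiv\sqrt{\frac{\mu}{L}}$, $\gamma_t\equiv\frac1L$,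 $\gamma'_t\equiv\frac1{\sqrt{\mu L}}$, $$\mathbb{E}f(x_t)-f(x_* )\le\Big(f(x_0)-f(x_* )+\frac\mu2\|z_0-x_*\|^2\Big)\exp\Big(-\sqrt{\frac\mu L}\,t\Big)+\sigma^2\frac1{\sqrt{\mu L}}.$$
   Context: $L$-smooth means $f(y)\le f(x)+\langle\nabla f(x),y-x\rangle+\frac L2\|y-x\|^2$ for all $x,y$; $\mu$-strongly convex means $f(y)\ge f(x)+\langle\nabla f(x),y-x\rangle+\frac\mu2\|y-x\|^2$ for all $x,y$. The Poisson point measure is $\mathrm{d}N(t,\xi)=\sum_{k\ge1}\delta_{(T_k,\xi_k)}(\mathrm{d}t,\mathrm{d}\xi)$ where $T_1,T_2-T_1,T_3-T_2,\dots$ are i.i.d. exponential of rate $1$ and $\xi_1,\xi_2,\dots$ are i.i.d. of law $\mathcal{P}$, independent of the $T_k$. The stochastic equation means: the processes are càdlàg (right continuous with left limits); at each $T_k$, $x_{T_k}=x_{T_k-}-\gamma_{T_k}\nabla f(x_{T_k-},\xi_k)$ and $z_{T_k}=z_{T_k-}-\gamma'_{T_k}\nabla f(x_{T_k-},\xi_k)$, with $x_{t-},z_{t-}$ left limits; between these times, $\mathrm{d}x_t=\eta_t(z_t-x_t)\,\mathrm{d}t$, $\mathrm{d}z_t=\eta'_t(x_t-z_t)\,\mathrm{d}t$. *)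

theory Defs
  imports "HOL-Probability.Probability"
begin

definition gradient :: "('a::euclidean_space \<Rightarrow> real) \<Rightarrow> 'a \<Rightarrow> 'a" where
  "gradient f x = (THE D. GDERIV f x :> D)"

lemma gradient_eqI:
  fixes f :: "'a::euclidean_space \<Rightarrow> real"
  assumes "GDERIV f x :> D"
  shows "gradient f x = D"
  unfolding gradient_def
proof (rule the_equality)
  fix D' assume "GDERIV f x :> D'"
  then have "(\<lambda>h. inner h D') = (\<lambda>h. inner h D)"
    using assms unfolding gderiv_def by (rule has_derivative_unique)
  then have "inner h (D' - D) = 0" for h
    by (simp add: inner_diff_right fun_eq_iff)
  then show "D' = D"
    using inner_eq_zero_iff[of "D' - D"] by simp
qed (rule assms)

lemma GDERIV_gradient:
  fixes f :: "'a::euclidean_space \<Rightarrow> real"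
  assumes "f differentiable (at x)"
  shows "GDERIV f x :> gradient f x"
proof -
  obtain F where F: "(f has_derivative F) (at x)"
    using assms unfolding differentiable_def by blast
  interpret F: bounded_linear F
    using F by (rule has_derivative_bounded_linear)
  have "F h = inner h (\<Sum>b\<in>Basis. F b *\<^sub>R b)" for h
  proof -
    have "F h = F (\<Sum>b\<in>Basis. inner h b *\<^sub>R b)"
      by (simp add: euclidean_representation)
    also have "\<dots> = inner h (\<Sum>b\<in>Basis. F b *\<^sub>R b)"
      by (simp add: F.sum F.scaleR inner_sum_right mult.commute)
    finally show ?thesis .
  qed
  then have "GDERIV f x :> (\<Sum>b\<in>Basis. F b *\<^sub>R b)"
    using F unfolding gderiv_def by (metis (no_types, lifting) ext)
  then show ?thesis
    using gradient_eqI by metis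
qed

definition L_smooth :: "real \<Rightarrow> ('a::euclidean_space \<Rightarrow> real) \<Rightarrow> bool" where
  "L_smooth L f \<longleftrightarrow>
    (\<forall>x y. f y \<le> f x + inner (gradient f x) (y - x) + L / 2 * (norm (y - x))\<^sup>2)"

definition strongly_convex :: "real \<Rightarrow> ('a::euclidean_space \<Rightarrow> real) \<Rightarrow> bool" where
  "strongly_convex \<mu> f \<longleftrightarrow>
    (\<forall>x y. f y \<ge> f x + inner (gradient f x) (y - x) + \<mu> / 2 * (norm (y - x))\<^sup>2)"

text \<open>
  \<open>g x \<xi>\<close> is the stochastic gradient at \<open>x\<close>. Joint measurability makes \<open>g\<close> evaluated at a
  random point and an independent mark a random variable. The integrability clauses give the
  two (Bochner) expectations their usual meaning, since the integral of a non-integrable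
  function is 0 by convention.
\<close>
definition stochastic_gradient ::
  "('a::euclidean_space \<Rightarrow> real) \<Rightarrow> 'x measure \<Rightarrow> ('a \<Rightarrow> 'x \<Rightarrow> 'a) \<Rightarrow> real \<Rightarrow> bool" where
  "stochastic_gradient f P g \<sigma> \<longleftrightarrow>
    (\<lambda>(x, \<xi>). g x \<xi>) \<in> borel_measurable (borel \<Otimes>\<^sub>M P) \<and>
    (\<forall>x. integrable P (g x) \<and> (\<integral>\<xi>. g x \<xi> \<partial>P) = gradient f x) \<and>
    (\<forall>x. integrable P (\<lambda>\<xi>. (norm (g x \<xi> - gradient f x))\<^sup>2) \<and>
         (\<integral>\<xi>. (norm (g x \<xi> - gradient f x))\<^sup>2 \<partial>P) \<le> \<sigma>\<^sup>2)"

text \<open>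
  The atoms \<open>(T k, \<xi> k)\<close>, \<open>k \<ge> 1\<close>, of a Poisson point measure with intensity
  \<open>dt \<otimes> P\<close>. \<open>T 0 = 0\<close> is a convention and not an atom; \<open>\<xi> 0\<close> is unused.
  Independence of the two sequences is stated for the sigma-algebras they generate, because
  \<^const>\<open>prob_space.indep_var\<close> requires both variables to have the same value type.
\<close>
definition poisson_atoms ::
  "'w measure \<Rightarrow> 'x measure \<Rightarrow> (nat \<Rightarrow> 'w \<Rightarrow> real) \<Rightarrow> (nat \<Rightarrow> 'w \<Rightarrow> 'x) \<Rightarrow> bool" where
  "poisson_atoms M P T \<xi> \<longleftrightarrow>
    (\<forall>\<omega>\<in>space M. T 0 \<omega> = 0) \<and>
    prob_space.indep_vars M (\<lambda>_. borel) (\<lambda>k \<omega>. T (Suc k) \<omega> - T k \<omega>) UNIV \<and>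
    (\<forall>k. distributed M lborel (\<lambda>\<omega>. T (Suc k) \<omega> - T k \<omega>) (exponential_density 1)) \<and>
    prob_space.indep_vars M (\<lambda>_. P) (\<lambda>k. \<xi> (Suc k)) UNIV \<and>
    (\<forall>k. distr M P (\<xi> (Suc k)) = P) \<and>
    prob_space.indep_set M
      (sets (vimage_algebra (space M) (\<lambda>\<omega> k. T (Suc k) \<omega>) (\<Pi>\<^sub>M k\<in>UNIV. borel)))
      (sets (vimage_algebra (space M) (\<lambda>\<omega> k. \<xi> (Suc k) \<omega>) (\<Pi>\<^sub>M k\<in>UNIV. P)))"

definition cadlag :: "(real \<Rightarrow> 'a::t2_space) \<Rightarrow> bool" where
  "cadlag y \<longleftrightarrow>
    (\<forall>t\<ge>0. (y \<longlongrightarrow> y t) (at_right t)) \<and> (\<forall>t>0. \<exists>l. (y \<longlongrightarrow> l) (at_left t))"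

definition left_lim :: "(real \<Rightarrow> 'a::t2_space) \<Rightarrow> real \<Rightarrow> 'a" where
  "left_lim y t = Lim (at_left t) y"

text \<open>
  One path of the process, for fixed jump times \<open>T k\<close> and marks \<open>\<xi> k\<close>. The differential
  equations are only required on the open intervals between jumps, so \<open>\<eta> 0\<close> is never
  evaluated and \<open>\<eta> t = 2 / t\<close> is admissible; in that case right continuity at 0 forces the
  two initial values to coincide.
\<close>
definition continuized_path ::
  "(nat \<Rightarrow> real) \<Rightarrow> (nat \<Rightarrow> 'x) \<Rightarrow> ('a::euclidean_space \<Rightarrow> 'x \<Rightarrow> 'a) \<Rightarrow>
   (real \<Rightarrow> real) \<Rightarrow> (real \<Rightarrow> real) \<Rightarrow> (real \<Rightarrow> real) \<Rightarrow> (real \<Rightarrow> real) \<Rightarrow>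
   'a \<Rightarrow> 'a \<Rightarrow> (real \<Rightarrow> 'a) \<Rightarrow> (real \<Rightarrow> 'a) \<Rightarrow> bool" where
  "continuized_path T \<xi> g \<eta> \<eta>' \<gamma> \<gamma>' x0 z0 x z \<longleftrightarrow>
    cadlag x \<and> cadlag z \<and> x 0 = x0 \<and> z 0 = z0 \<and>
    (\<forall>k\<ge>1.
      x (T k) = left_lim x (T k) - \<gamma> (T k) *\<^sub>R g (left_lim x (T k)) (\<xi> k) \<and>
      z (T k) = left_lim z (T k) - \<gamma>' (T k) *\<^sub>R g (left_lim x (T k)) (\<xi> k)) \<and>
    (\<forall>k. \<forall>t\<in>{T k<..<T (Suc k)}.
      (x has_vector_derivative \<eta> t *\<^sub>R (z t - x t)) (at t) \<and>
      (z has_vector_derivative \<eta>' t *\<^sub>R (x t - z t)) (at t))"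

definition continuized_process ::
  "'w measure \<Rightarrow> (nat \<Rightarrow> 'w \<Rightarrow> real) \<Rightarrow> (nat \<Rightarrow> 'w \<Rightarrow> 'x) \<Rightarrow>
   ('a::euclidean_space \<Rightarrow> 'x \<Rightarrow> 'a) \<Rightarrow>
   (real \<Rightarrow> real) \<Rightarrow> (real \<Rightarrow> real) \<Rightarrow> (real \<Rightarrow> real) \<Rightarrow> (real \<Rightarrow> real) \<Rightarrow>
   'a \<Rightarrow> 'a \<Rightarrow> (real \<Rightarrow> 'w \<Rightarrow> 'a) \<Rightarrow> (real \<Rightarrow> 'w \<Rightarrow> 'a) \<Rightarrow> bool" where
  "continuized_process M T \<xi> g \<eta> \<eta>' \<gamma> \<gamma>' x0 z0 x z \<longleftrightarrow>
    (\<forall>t\<ge>0. x t \<in> borel_measurable M \<and> z t \<in> borel_measurable M) \<and>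
    (AE \<omega> in M. continuized_path (\<lambda>k. T k \<omega>) (\<lambda>k. \<xi> k \<omega>) g \<eta> \<eta>' \<gamma> \<gamma>' x0 z0
      (\<lambda>t. x t \<omega>) (\<lambda>t. z t \<omega>))"

end

(* Between jumps the equations are linear and are solved by an explicit flow, so the state at
   the jump times is a Markov chain driven by the i.i.d. waiting times and marks. With
   A t = t^2 / (4 L), B = 1 in the convex case and A t = exp (eta t), B = mu A,
   eta = sqrt (mu / L) in the strongly convex case, consider
     A (f x - f xs) + B / 2 |z - xs|^2 - sigma^2 (integral of A / L from 0 to t).
   Its drift along the flow plus its mean jump is at most 0. Multiplying by the density exp (-r)
   of the waiting time turns this into a total derivative, so the process stopped at time t
   is a supermartingale along the jump times. Almost surely some jump time exceeds t,
   and Fatou's lemma gives the bound at time t. *)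
theory Submission
  imports Defs
begin

section \<open>Chains driven by Poisson atoms\<close>

text \<open>The coefficients are forced by cancellation. A jump adds \<open>A |g|^2 / (2 L)\<close>
  to the first energy term by smoothness and \<open>B \<gamma>'^2 |g|^2 / 2\<close> to the second.
  Requiring \<open>B \<gamma>'^2 = A / L\<close> makes the sum \<open>A |g|^2 / L\<close>, whose
  mean cancels the descent term \<open>- A |grad f|^2 / L\<close> up to the noise
  \<open>\<sigma>^2 A / L\<close>. Requiring \<open>A \<eta> = B \<gamma>' = A'\<close> removes
  \<open>z\<close> from the remaining gradient products and leaves the convexity inequality at
  \<open>xs\<close>. With \<open>B = 1\<close> this reads \<open>A' = sqrt (A / L)\<close>, hence
  \<open>A t = t^2 / (4 L)\<close>; with \<open>B = \<mu> A\<close> it gives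
  \<open>\<gamma>' = 1 / sqrt (\<mu> L)\<close> and \<open>\<eta> = sqrt (\<mu> / L)\<close>. The
  obstacle is integrability: the energy is not known in advance to have finite mean. A nonnegative
  energy and extended nonnegative integrals bypass the question, and integrability of
  \<open>f (x t)\<close> comes out at the end. They also turn the Markov property into Fubini on
  product spaces of waiting times and marks.\<close>

primrec chain :: "('s \<Rightarrow> 'a \<Rightarrow> 'b \<Rightarrow> 's) \<Rightarrow> 's \<Rightarrow> (nat \<Rightarrow> 'a) \<Rightarrow> (nat \<Rightarrow> 'b) \<Rightarrow> nat \<Rightarrow> 's" where
  "chain F s a b 0 = s"
| "chain F s a b (Suc n) = F (chain F s a b n) (a n) (b n)"

text \<open>The recursion consumes inputs at the end, while product measures are peeled from the
  front. Absorbing the first pair into the start state reconciles the two, so inductions must let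
  the start vary.\<close>

lemma chain_case_nat:
  "chain F s (case_nat u a) (case_nat v b) (Suc n) = chain F (F s u v) a b n"
  by (induction n) auto

lemma measurable_chain:
  assumes F: "(\<lambda>(s, a, b). F s a b) \<in> N \<Otimes>\<^sub>M (A \<Otimes>\<^sub>M B) \<rightarrow>\<^sub>M N"
  shows "(\<lambda>(s, a, b). chain F s a b n) \<in>
    N \<Otimes>\<^sub>M ((\<Pi>\<^sub>M i\<in>(UNIV::nat set). A) \<Otimes>\<^sub>M (\<Pi>\<^sub>M i\<in>(UNIV::nat set). B)) \<rightarrow>\<^sub>M N"
proof (induction n)
  case 0
  then show ?case by (simp add: case_prod_beta')
next
  case (Suc n)
  let ?Q = "N \<Otimes>\<^sub>M ((\<Pi>\<^sub>M i\<in>(UNIV::nat set). A) \<Otimes>\<^sub>M (\<Pi>\<^sub>M i\<in>(UNIV::nat set). B))"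
  have [measurable]: "(\<lambda>p. chain F (fst p) (fst (snd p)) (snd (snd p)) n) \<in> ?Q \<rightarrow>\<^sub>M N"
    using Suc by (simp add: case_prod_beta')
  have "(\<lambda>p. (chain F (fst p) (fst (snd p)) (snd (snd p)) n, fst (snd p) n, snd (snd p) n))
      \<in> ?Q \<rightarrow>\<^sub>M N \<Otimes>\<^sub>M (A \<Otimes>\<^sub>M B)"
    by measurable
  from measurable_compose[OF this F] show ?case
    by (simp add: case_prod_beta')
qed

lemma nn_integral_PiM_case_nat:
  assumes "prob_space A" and h: "h \<in> borel_measurable (\<Pi>\<^sub>M i\<in>(UNIV::nat set). A)"
  shows "(\<integral>\<^sup>+a. h a \<partial>(\<Pi>\<^sub>M i\<in>UNIV. A)) = (\<integral>\<^sup>+u. \<integral>\<^sup>+a. h (case_nat u a) \<partial>(\<Pi>\<^sub>M i\<in>UNIV. A) \<partial>A)"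
proof -
  interpret A: prob_space A by fact
  interpret S: sequence_space A ..
  note [measurable] = h
  have "(\<integral>\<^sup>+a. h a \<partial>S.S) = (\<integral>\<^sup>+a. h a \<partial>distr (A \<Otimes>\<^sub>M S.S) S.S (\<lambda>(s, \<omega>). case_nat s \<omega>))"
    by (simp add: S.PiM_iter)
  also have "\<dots> = (\<integral>\<^sup>+p. h (case_nat (fst p) (snd p)) \<partial>(A \<Otimes>\<^sub>M S.S))"
    by (subst nn_integral_distr) (auto simp: case_prod_beta')
  also have "\<dots> = (\<integral>\<^sup>+u. \<integral>\<^sup>+a. h (case_nat u a) \<partial>S.S \<partial>A)"
    by (subst S.P.nn_integral_fst[symmetric]) simp_all
  finally show ?thesis .
qed

text \<open>Once the first pair \<open>(u, v)\<close> is split off, the rest of the chain starts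
  afresh from \<open>F s u v\<close>, and the induction hypothesis for that state applies. Waits and
  marks keep separate product spaces because their independence is given between the two whole
  sequences.\<close>

lemma chain_supermartingale:
  assumes "prob_space A" "prob_space B"
    and F: "(\<lambda>(s, a, b). F s a b) \<in> N \<Otimes>\<^sub>M (A \<Otimes>\<^sub>M B) \<rightarrow>\<^sub>M N"
    and V: "V \<in> borel_measurable N"
    and step: "\<And>s. s \<in> space N \<Longrightarrow> (\<integral>\<^sup>+a. \<integral>\<^sup>+b. V (F s a b) \<partial>B \<partial>A) \<le> (V s :: ennreal)"
    and s: "s \<in> space N"
  shows "(\<integral>\<^sup>+a. \<integral>\<^sup>+b. V (chain F s a b n) \<partial>(\<Pi>\<^sub>M i\<in>(UNIV::nat set). B)
            \<partial>(\<Pi>\<^sub>M i\<in>(UNIV::nat set). A)) \<le> V s"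
  using s
proof (induction n arbitrary: s)
  interpret A: prob_space A by fact
  interpret B: prob_space B by fact
  interpret SA: sequence_space A ..
  interpret SB: sequence_space B ..
  {
    case 0
    then show ?case by (simp add: SA.P.emeasure_space_1 SB.P.emeasure_space_1)
  next
    case (Suc n)
    note [measurable] = V
    have Fm: "F s u v \<in> space N" if "u \<in> space A" "v \<in> space B" for u v
      using measurable_space[OF F, of "(s, u, v)"] that Suc.prems by (auto simp: space_pair_measure)
    have C: "(\<lambda>x. chain F (f x) (g x) (h x) k) \<in> K \<rightarrow>\<^sub>M N"
      if "f \<in> K \<rightarrow>\<^sub>M N" "g \<in> K \<rightarrow>\<^sub>M SA.S" "h \<in> K \<rightarrow>\<^sub>M SB.S" for f g h and K :: "'z measure" and k
      using measurable_compose[OF measurable_Pair[OF that(1) measurable_Pair[OF that(2,3)]]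
          measurable_chain[OF F, of k]] by simp
    have G: "(\<lambda>x. F (f x) (g x) (h x)) \<in> K \<rightarrow>\<^sub>M N"
      if "f \<in> K \<rightarrow>\<^sub>M N" "g \<in> K \<rightarrow>\<^sub>M A" "h \<in> K \<rightarrow>\<^sub>M B" for f g h and K :: "'z measure"
      using measurable_compose[OF measurable_Pair[OF that(1) measurable_Pair[OF that(2,3)]] F] by simp
    note [measurable (raw)] = C G
    have [measurable]: "(\<lambda>x. s) \<in> K \<rightarrow>\<^sub>M N" for K :: "'z measure"
      using Suc.prems by simp
    have "(\<integral>\<^sup>+a. \<integral>\<^sup>+b. V (chain F s a b (Suc n)) \<partial>SB.S \<partial>SA.S)
        = (\<integral>\<^sup>+u. \<integral>\<^sup>+a. \<integral>\<^sup>+b. V (chain F s (case_nat u a) b (Suc n)) \<partial>SB.S \<partial>SA.S \<partial>A)"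
      by (rule nn_integral_PiM_case_nat[OF \<open>prob_space A\<close>])
        (unfold chain.simps, measurable)
    also have "\<dots> = (\<integral>\<^sup>+u. \<integral>\<^sup>+a. \<integral>\<^sup>+v. \<integral>\<^sup>+b. V (chain F (F s u v) a b n) \<partial>SB.S \<partial>B \<partial>SA.S \<partial>A)"
    proof (intro nn_integral_cong)
      fix u a assume ua: "u \<in> space A" "a \<in> space SA.S"
      have [measurable]: "(\<lambda>x. case_nat u a) \<in> K \<rightarrow>\<^sub>M SA.S" for K :: "'z measure"
        using ua by simp
      have "(\<integral>\<^sup>+b. V (chain F s (case_nat u a) b (Suc n)) \<partial>SB.S)
        = (\<integral>\<^sup>+v. \<integral>\<^sup>+b. V (chain F s (case_nat u a) (case_nat v b) (Suc n)) \<partial>SB.S \<partial>B)"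
        by (rule nn_integral_PiM_case_nat[OF \<open>prob_space B\<close>]) measurable
      then show "(\<integral>\<^sup>+b. V (chain F s (case_nat u a) b (Suc n)) \<partial>SB.S)
        = (\<integral>\<^sup>+v. \<integral>\<^sup>+b. V (chain F (F s u v) a b n) \<partial>SB.S \<partial>B)"
        by (simp only: chain_case_nat)
    qed
    \<comment> \<open>The first mark has to move outside the tail of the waits before the induction
      hypothesis can be used at \<open>F s u v\<close>.\<close>
    also have "\<dots> = (\<integral>\<^sup>+u. \<integral>\<^sup>+v. \<integral>\<^sup>+a. \<integral>\<^sup>+b. V (chain F (F s u v) a b n) \<partial>SB.S \<partial>SA.S \<partial>B \<partial>A)"
    proof (intro nn_integral_cong)
      interpret P: pair_sigma_finite B SA.S ..
      fix u assume u: "u \<in> space A"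
      have [measurable]: "(\<lambda>x. u) \<in> K \<rightarrow>\<^sub>M A" for K :: "'z measure"
        using u by simp
      show "(\<integral>\<^sup>+a. \<integral>\<^sup>+v. \<integral>\<^sup>+b. V (chain F (F s u v) a b n) \<partial>SB.S \<partial>B \<partial>SA.S)
        = (\<integral>\<^sup>+v. \<integral>\<^sup>+a. \<integral>\<^sup>+b. V (chain F (F s u v) a b n) \<partial>SB.S \<partial>SA.S \<partial>B)"
        by (rule P.Fubini') measurable
    qed
    also have "\<dots> \<le> (\<integral>\<^sup>+u. \<integral>\<^sup>+v. V (F s u v) \<partial>B \<partial>A)"
      by (intro nn_integral_mono Suc.IH Fm)
    also have "\<dots> \<le> V s"
      by (rule step) fact
    finally show ?case .
  }
qed

text \<open>A sigma-finite product is determined by rectangles, and the preimage of a rectangle is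
  an intersection of one event from each generated sigma-algebra. Working with
  \<open>indep_set\<close> allows \<open>X\<close> and \<open>Y\<close> to have different value
  types.\<close>

lemma (in prob_space) distr_Pair_indep_set:
  assumes ind: "indep_set (sets (vimage_algebra (space M) X A)) (sets (vimage_algebra (space M) Y B))"
    and X: "random_variable A X" and Y: "random_variable B Y"
  shows "distr M (A \<Otimes>\<^sub>M B) (\<lambda>\<omega>. (X \<omega>, Y \<omega>)) = distr M A X \<Otimes>\<^sub>M distr M B Y"
proof (rule pair_measure_eqI[symmetric])
  note [measurable] = X Y
  show "sigma_finite_measure (distr M A X)" "sigma_finite_measure (distr M B Y)"
    by (auto intro!: prob_space_imp_sigma_finite prob_space_distr)
  show "sets (distr M A X \<Otimes>\<^sub>M distr M B Y) = sets (distr M (A \<Otimes>\<^sub>M B) (\<lambda>\<omega>. (X \<omega>, Y \<omega>)))"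
    by (simp cong: sets_pair_measure_cong)
  fix C D assume "C \<in> sets (distr M A X)" "D \<in> sets (distr M B Y)"
  then have [measurable]: "C \<in> sets A" "D \<in> sets B" by auto
  have "emeasure (distr M A X) C * emeasure (distr M B Y) D
      = ennreal (prob (X -` C \<inter> space M) * prob (Y -` D \<inter> space M))"
    by (simp add: emeasure_distr emeasure_eq_measure ennreal_mult)
  also have "prob (X -` C \<inter> space M) * prob (Y -` D \<inter> space M)
      = prob ((X -` C \<inter> space M) \<inter> (Y -` D \<inter> space M))"
    by (rule indep_setD[OF ind, symmetric]) (auto intro!: in_vimage_algebra)
  also have "(X -` C \<inter> space M) \<inter> (Y -` D \<inter> space M) = (\<lambda>\<omega>. (X \<omega>, Y \<omega>)) -` (C \<times> D) \<inter> space M"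
    by auto
  also have "ennreal (prob \<dots>) = emeasure (distr M (A \<Otimes>\<^sub>M B) (\<lambda>\<omega>. (X \<omega>, Y \<omega>))) (C \<times> D)"
    by (simp add: emeasure_distr emeasure_eq_measure)
  finally show "emeasure (distr M A X) C * emeasure (distr M B Y) D
    = emeasure (distr M (A \<Otimes>\<^sub>M B) (\<lambda>\<omega>. (X \<omega>, Y \<omega>))) (C \<times> D)" .
qed

section \<open>Waiting times and marks of the Poisson atoms\<close>

abbreviation exp_measure :: "real measure" where
  "exp_measure \<equiv> density lborel (exponential_density 1)"

lemma poisson_atoms_time_eq_sum:
  assumes "poisson_atoms M P T \<xi>" "\<omega> \<in> space M"
  shows "T k \<omega> = (\<Sum>i<k. T (Suc i) \<omega> - T i \<omega>)"
  using assms by (induction k) (auto simp: poisson_atoms_def)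

lemma poisson_atoms_time_measurable:
  assumes "prob_space M" and PA: "poisson_atoms M P T \<xi>"
  shows "T k \<in> borel_measurable M"
proof -
  interpret prob_space M by fact
  have [measurable]: "random_variable borel (\<lambda>\<omega>. T (Suc k) \<omega> - T k \<omega>)" for k
    using PA by (auto simp: poisson_atoms_def indep_vars_def)
  have "random_variable borel (\<lambda>\<omega>. \<Sum>i<k. T (Suc i) \<omega> - T i \<omega>)" by measurable
  then show ?thesis by (subst measurable_cong[OF poisson_atoms_time_eq_sum[OF PA]])
qed

text \<open>Carries expectations under \<open>M\<close> to the product space on which the chain
  inequality is proved.\<close>

lemma nn_integral_poisson_atoms:
  assumes M: "prob_space M" and "prob_space P" and PA: "poisson_atoms M P T \<xi>"
    and h: "h \<in> borel_measurable
      ((\<Pi>\<^sub>M i\<in>(UNIV::nat set). exp_measure) \<Otimes>\<^sub>M (\<Pi>\<^sub>M i\<in>(UNIV::nat set). P))"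
  shows "(\<lambda>\<omega>. (\<lambda>k. T (Suc k) \<omega> - T k \<omega>, \<lambda>k. \<xi> (Suc k) \<omega>)) \<in> M \<rightarrow>\<^sub>M
      (\<Pi>\<^sub>M i\<in>(UNIV::nat set). exp_measure) \<Otimes>\<^sub>M (\<Pi>\<^sub>M i\<in>(UNIV::nat set). P)" (is ?meas)
    and "(\<integral>\<^sup>+\<omega>. h (\<lambda>k. T (Suc k) \<omega> - T k \<omega>, \<lambda>k. \<xi> (Suc k) \<omega>) \<partial>M)
      = (\<integral>\<^sup>+a. \<integral>\<^sup>+b. h (a, b) \<partial>(\<Pi>\<^sub>M i\<in>UNIV. P) \<partial>(\<Pi>\<^sub>M i\<in>UNIV. exp_measure))" (is ?int)
proof -
  interpret prob_space M by fact
  interpret P: prob_space P by fact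
  interpret E: prob_space exp_measure by (rule prob_space_exponential_density) simp
  interpret SP: sequence_space P ..
  interpret SE: sequence_space exp_measure ..
  let ?B = "\<Pi>\<^sub>M i\<in>(UNIV::nat set). (borel :: real measure)"
  let ?\<tau> = "\<lambda>\<omega> k. T (Suc k) \<omega> - T k \<omega>" and ?T = "\<lambda>\<omega> k. T (Suc k) \<omega>" and ?X = "\<lambda>\<omega> k. \<xi> (Suc k) \<omega>"
  have T0: "\<And>\<omega>. \<omega> \<in> space M \<Longrightarrow> T 0 \<omega> = 0"
    and ind\<tau>: "indep_vars (\<lambda>_. borel) (\<lambda>k \<omega>. ?\<tau> \<omega> k) UNIV"
    and dist\<tau>: "\<And>k. distributed M lborel (\<lambda>\<omega>. ?\<tau> \<omega> k) (exponential_density 1)"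
    and ind\<xi>: "indep_vars (\<lambda>_. P) (\<lambda>k. \<xi> (Suc k)) UNIV"
    and dist\<xi>: "\<And>k. distr M P (\<xi> (Suc k)) = P"
    and ind: "indep_set (sets (vimage_algebra (space M) ?T ?B)) (sets (vimage_algebra (space M) ?X SP.S))"
    using PA by (auto simp: poisson_atoms_def)
  have \<tau>m[measurable]: "random_variable borel (\<lambda>\<omega>. ?\<tau> \<omega> k)" for k
    using ind\<tau> by (auto simp: indep_vars_def)
  have \<xi>m[measurable]: "random_variable P (\<xi> (Suc k))" for k
    using ind\<xi> by (auto simp: indep_vars_def)
  have setsE: "sets SE.S = sets ?B"
    by (intro sets_PiM_cong) auto
  note [measurable] = poisson_atoms_time_measurable[OF M PA]
  have \<tau>B[measurable]: "random_variable ?B ?\<tau>"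
    by (rule measurable_PiM_single') (auto simp: space_PiM)
  have TB[measurable]: "random_variable ?B ?T"
    by (rule measurable_PiM_single') (auto simp: space_PiM)
  have XB[measurable]: "random_variable SP.S ?X"
    using \<xi>m by (intro measurable_PiM_single') (auto simp: space_PiM measurable_def Pi_iff)
  \<comment> \<open>Independence from the marks is given for the jump times but wanted for the
    waiting times. The latter are a measurable image of the former under \<open>D\<close>, so they
    generate a smaller sigma-algebra.\<close>
  define D where "D y k = (if k = 0 then y 0 else y k - y (k - 1))" for y :: "nat \<Rightarrow> real" and k
  have [measurable]: "D \<in> ?B \<rightarrow>\<^sub>M ?B"
    unfolding D_def by (rule measurable_PiM_single') (auto simp: space_PiM)
  have D: "D (?T \<omega>) = ?\<tau> \<omega>" if "\<omega> \<in> space M" for \<omega>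
    using T0[OF that] by (auto simp: D_def fun_eq_iff)
  have "sets (vimage_algebra (space M) ?\<tau> ?B) \<subseteq> sets (vimage_algebra (space M) ?T ?B)"
  proof
    fix C assume "C \<in> sets (vimage_algebra (space M) ?\<tau> ?B)"
    then obtain C' where C: "C = ?\<tau> -` C' \<inter> space M" and [measurable]: "C' \<in> sets ?B"
      by (auto simp: sets_vimage_algebra2 space_PiM)
    have "C = ?T -` (D -` C' \<inter> space ?B) \<inter> space M"
      using D by (auto simp: C space_PiM)
    also have "\<dots> \<in> sets (vimage_algebra (space M) ?T ?B)"
      by (intro in_vimage_algebra) measurable
    finally show "C \<in> sets (vimage_algebra (space M) ?T ?B)" .
  qed
  with ind have ind': "indep_set (sets (vimage_algebra (space M) ?\<tau> ?B)) (sets (vimage_algebra (space M) ?X SP.S))"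
    unfolding indep_sets2_eq by blast
  have "distr M ?B ?\<tau> = (\<Pi>\<^sub>M k\<in>UNIV. distr M borel (\<lambda>\<omega>. ?\<tau> \<omega> k))"
    using iffD1[OF indep_vars_iff_distr_eq_PiM ind\<tau>] by (simp add: restrict_UNIV)
  also have "\<dots> = SE.S"
  proof (rule arg_cong[where f="PiM UNIV"], rule ext)
    fix k
    have "distr M borel (\<lambda>\<omega>. ?\<tau> \<omega> k) = distr M lborel (\<lambda>\<omega>. ?\<tau> \<omega> k)"
      by (rule distr_cong) auto
    then show "distr M borel (\<lambda>\<omega>. ?\<tau> \<omega> k) = exp_measure"
      using dist\<tau>[of k] by (simp add: distributed_def)
  qed
  finally have d\<tau>: "distr M ?B ?\<tau> = SE.S" .
  have dX: "distr M SP.S ?X = SP.S"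
    using iffD1[OF indep_vars_iff_distr_eq_PiM ind\<xi>] by (simp add: dist\<xi> restrict_UNIV)
  have d: "distr M (?B \<Otimes>\<^sub>M SP.S) (\<lambda>\<omega>. (?\<tau> \<omega>, ?X \<omega>)) = SE.S \<Otimes>\<^sub>M SP.S"
    using distr_Pair_indep_set[OF ind' \<tau>B XB] by (simp add: d\<tau> dX)
  have m: "(\<lambda>\<omega>. (?\<tau> \<omega>, ?X \<omega>)) \<in> M \<rightarrow>\<^sub>M ?B \<Otimes>\<^sub>M SP.S" by measurable
  then show ?meas
    by (subst measurable_cong_sets[OF refl sets_pair_measure_cong[OF setsE refl]])
  have h': "h \<in> borel_measurable (?B \<Otimes>\<^sub>M SP.S)"
    using h by (simp cong: measurable_cong_sets add: sets_pair_measure_cong[OF setsE refl])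
  have "(\<integral>\<^sup>+\<omega>. h (?\<tau> \<omega>, ?X \<omega>) \<partial>M) = (\<integral>\<^sup>+p. h p \<partial>(SE.S \<Otimes>\<^sub>M SP.S))"
    unfolding d[symmetric] using m h' by (subst nn_integral_distr) auto
  also have "\<dots> = (\<integral>\<^sup>+a. \<integral>\<^sup>+b. h (a, b) \<partial>SP.S \<partial>SE.S)"
    using h by (subst SP.P.nn_integral_fst[symmetric]) auto
  finally show ?int .
qed

lemma poisson_atoms_increasing:
  assumes "prob_space M" and PA: "poisson_atoms M P T \<xi>"
  shows "AE \<omega> in M. T 0 \<omega> = 0 \<and> (\<forall>k. T k \<omega> < T (Suc k) \<omega>)"
proof -
  interpret prob_space M by fact
  have dist: "distributed M lborel (\<lambda>\<omega>. T (Suc k) \<omega> - T k \<omega>) (exponential_density 1)" for k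
    using PA by (simp add: poisson_atoms_def)
  have "AE \<omega> in M. T k \<omega> < T (Suc k) \<omega>" for k
  proof -
    have "prob {\<omega> \<in> space M. 0 < T (Suc k) \<omega> - T k \<omega>} = 1"
      using exponential_distributedD_gt[OF dist[of k], of 0] by simp
    from AE_prob_1[OF this] show ?thesis by auto
  qed
  then have "AE \<omega> in M. \<forall>k. T k \<omega> < T (Suc k) \<omega>" by (simp add: AE_all_countable)
  moreover have "AE \<omega> in M. T 0 \<omega> = 0" using PA by (auto simp: poisson_atoms_def)
  ultimately show ?thesis by auto
qed

lemma nn_integral_exp_measure:
  assumes [measurable]: "h \<in> borel_measurable borel"
  shows "(\<integral>\<^sup>+r. h r \<partial>exp_measure) = (\<integral>\<^sup>+r. ennreal (exp (- r)) * h r * indicator {0..} r \<partial>lborel)"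
  by (subst nn_integral_density)
    (auto intro!: nn_integral_cong simp: exponential_density_def split: split_indicator)

text \<open>Laplace transform: each wait has \<open>E exp (- \<tau>) = 1/2\<close>, so
  \<open>E exp (- T n) = (1/2)^n\<close> by independence. Markov's inequality then bounds the
  probability that all jumps stay below \<open>t\<close> by \<open>exp t * (1/2)^n\<close> for every
  \<open>n\<close>.\<close>

lemma poisson_atoms_unbounded:
  assumes M: "prob_space M" and PA: "poisson_atoms M P T \<xi>"
  shows "AE \<omega> in M. \<exists>k. t < T k \<omega>"
proof -
  interpret prob_space M by fact
  let ?\<tau> = "\<lambda>\<omega> k. T (Suc k) \<omega> - T k \<omega>"
  have ind\<tau>: "indep_vars (\<lambda>_. borel) (\<lambda>k \<omega>. ?\<tau> \<omega> k) UNIV"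
    and dist\<tau>: "\<And>k. distributed M lborel (\<lambda>\<omega>. ?\<tau> \<omega> k) (exponential_density 1)"
    using PA by (auto simp: poisson_atoms_def)
  note Tsum = poisson_atoms_time_eq_sum[OF PA]
  note [measurable] = poisson_atoms_time_measurable[OF M PA]
  have half: "(\<integral>\<^sup>+\<omega>. ennreal (exp (- ?\<tau> \<omega> k)) \<partial>M) = ennreal (1/2)" for k
  proof -
    have "(\<integral>\<^sup>+\<omega>. ennreal (exp (- ?\<tau> \<omega> k)) \<partial>M)
        = (\<integral>\<^sup>+r. ennreal (exponential_density 1 r) * ennreal (exp (- r)) \<partial>lborel)"
      by (rule distributed_nn_integral[OF dist\<tau>, symmetric]) simp
    \<comment> \<open>\<open>exp (- r)\<close> times the density of rate 1 is half the density of
      rate 2.\<close>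
    also have "\<dots> = (\<integral>\<^sup>+r. ennreal (1/2) * ennreal (exponential_density 2 r) \<partial>lborel)"
      by (intro nn_integral_cong, subst (1 2) ennreal_mult[symmetric])
        (auto simp: exponential_density_def exp_add[symmetric])
    also have "\<dots> = ennreal (1/2) * emeasure (density lborel (exponential_density 2)) (space lborel)"
      by (simp add: nn_integral_cmult emeasure_density)
    also have "\<dots> = ennreal (1/2)"
      using prob_space.emeasure_space_1[OF prob_space_exponential_density[of 2]] by simp
    finally show ?thesis .
  qed
  have pow: "(\<integral>\<^sup>+\<omega>. ennreal (exp (- T n \<omega>)) \<partial>M) = ennreal ((1/2) ^ n)" for n
  proof -
    have "(\<integral>\<^sup>+\<omega>. ennreal (exp (- T n \<omega>)) \<partial>M) = (\<integral>\<^sup>+\<omega>. (\<Prod>k<n. ennreal (exp (- ?\<tau> \<omega> k))) \<partial>M)"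
      by (intro nn_integral_cong, subst Tsum)
        (simp_all add: exp_sum prod_ennreal sum_negf[symmetric] del: sum_negf sum_subtractf minus_diff_eq)
    also have "\<dots> = (\<Prod>k<n. \<integral>\<^sup>+\<omega>. ennreal (exp (- ?\<tau> \<omega> k)) \<partial>M)"
      by (rule indep_vars_nn_integral)
        (rule indep_vars_compose2[OF indep_vars_subset[OF ind\<tau>], where Y="\<lambda>_ r. ennreal (exp (- r))"]
          | simp)+
    also have "\<dots> = ennreal ((1/2) ^ n)"
      by (simp only: half prod_constant card_lessThan) (rule ennreal_power, simp)
    finally show ?thesis .
  qed
  let ?N = "{\<omega> \<in> space M. \<forall>k. T k \<omega> \<le> t}"
  have le: "emeasure M ?N \<le> ennreal (exp t * (1/2) ^ n)" for n
  proof -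
    have "emeasure M ?N = (\<integral>\<^sup>+\<omega>. indicator ?N \<omega> \<partial>M)"
      by simp
    also have "\<dots> \<le> (\<integral>\<^sup>+\<omega>. ennreal (exp t) * ennreal (exp (- T n \<omega>)) \<partial>M)"
      by (intro nn_integral_mono)
        (auto simp: ennreal_mult[symmetric] exp_add[symmetric] indicator_def)
    also have "\<dots> = ennreal (exp t * (1/2) ^ n)"
      by (simp add: nn_integral_cmult pow ennreal_mult)
    finally show ?thesis .
  qed
  have "(\<lambda>n. ennreal (exp t * (1/2) ^ n)) \<longlonglongrightarrow> ennreal (exp t * 0)"
    by (intro tendsto_ennrealI tendsto_mult tendsto_const LIMSEQ_power_zero) simp
  from LIMSEQ_le_const[OF this] le have "emeasure M ?N \<le> 0" by simp
  then have "?N \<in> null_sets M" by (simp add: null_sets_def)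
  from AE_not_in[OF this] AE_space show ?thesis by eventually_elim (auto simp: not_le)
qed

section \<open>Stochastic gradient steps\<close>

text \<open>Restriction to the line through \<open>x\<close> and \<open>y\<close> reduces this to
  the tangent bound for convex functions of one real variable.\<close>

lemma convex_gradient_ineq:
  fixes f :: "'a::euclidean_space \<Rightarrow> real"
  assumes cv: "convex_on UNIV f" and d: "f differentiable (at x)"
  shows "f x + inner (gradient f x) (y - x) \<le> f y"
proof -
  define \<phi> where "\<phi> s = f (x + s *\<^sub>R (y - x))" for s :: real
  have "convex_on UNIV \<phi>"
  proof (rule convex_onI)
    fix t u v :: real assume t: "0 < t" "t < 1"
    have "\<phi> ((1 - t) *\<^sub>R u + t *\<^sub>R v)
        = f ((1 - t) *\<^sub>R (x + u *\<^sub>R (y - x)) + t *\<^sub>R (x + v *\<^sub>R (y - x)))"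
      unfolding \<phi>_def by (rule arg_cong[where f=f]) (simp add: algebra_simps)
    also have "\<dots> \<le> (1 - t) * \<phi> u + t * \<phi> v"
      unfolding \<phi>_def using convex_onD[OF cv, of t] t by auto
    finally show "\<phi> ((1 - t) *\<^sub>R u + t *\<^sub>R v) \<le> (1 - t) * \<phi> u + t * \<phi> v" .
  qed simp
  moreover have "(\<phi> has_real_derivative inner (gradient f x) (y - x)) (at 0)"
  proof -
    have "((\<lambda>s. x + s *\<^sub>R (y - x)) has_derivative (\<lambda>h. h *\<^sub>R (y - x))) (at 0)"
      by (auto intro!: derivative_eq_intros)
    moreover have "(f has_derivative (\<lambda>h. inner h (gradient f x))) (at (x + 0 *\<^sub>R (y - x)))"
      using GDERIV_gradient[OF d] by (simp add: gderiv_def)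
    ultimately have "(\<phi> has_derivative (\<lambda>h. inner (h *\<^sub>R (y - x)) (gradient f x))) (at 0)"
      unfolding \<phi>_def by (rule has_derivative_compose)
    then show ?thesis
      by (simp add: has_field_derivative_def inner_commute mult.commute[of _ "inner _ _"] mult_commute_abs)
  qed
  ultimately have "\<phi> 1 - \<phi> 0 \<ge> inner (gradient f x) (y - x) * (1 - 0)"
    by (intro convex_on_imp_above_tangent[where A=UNIV]) auto
  then show ?thesis by (simp add: \<phi>_def)
qed

lemma stochastic_gradient_moments:
  fixes f :: "'a::euclidean_space \<Rightarrow> real"
  assumes "prob_space P" and sg: "stochastic_gradient f P g \<sigma>"
  defines "G \<equiv> gradient f"
  shows "integrable P (\<lambda>e. inner (g x e) w)" "(\<integral>e. inner (g x e) w \<partial>P) = inner (G x) w"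
    and "integrable P (\<lambda>e. (norm (g x e))\<^sup>2)" "(\<integral>e. (norm (g x e))\<^sup>2 \<partial>P) \<le> (norm (G x))\<^sup>2 + \<sigma>\<^sup>2"
proof -
  interpret prob_space P by fact
  have i: "integrable P (g x)" "(\<integral>e. g x e \<partial>P) = G x"
    and v: "integrable P (\<lambda>e. (norm (g x e - G x))\<^sup>2)" "(\<integral>e. (norm (g x e - G x))\<^sup>2 \<partial>P) \<le> \<sigma>\<^sup>2"
    using sg by (auto simp: stochastic_gradient_def G_def)
  show lin: "integrable P (\<lambda>e. inner (g x e) w)" "(\<integral>e. inner (g x e) w \<partial>P) = inner (G x) w" for w
    using i by auto
  \<comment> \<open>Bias-variance expansion; it also transfers integrability from the variance to
    the second moment.\<close>
  have *: "(\<lambda>e. (norm (g x e))\<^sup>2) = (\<lambda>e. (norm (g x e - G x))\<^sup>2 + 2 * inner (g x e) (G x) - (norm (G x))\<^sup>2)"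
    by (auto simp: fun_eq_iff power2_norm_eq_inner inner_diff inner_commute)
  show "integrable P (\<lambda>e. (norm (g x e))\<^sup>2)"
    unfolding * using v lin by simp
  have "(\<integral>e. (norm (g x e))\<^sup>2 \<partial>P) = (\<integral>e. (norm (g x e - G x))\<^sup>2 \<partial>P) + 2 * inner (G x) (G x) - (norm (G x))\<^sup>2"
    unfolding * using v lin by (simp add: prob_space)
  then show "(\<integral>e. (norm (g x e))\<^sup>2 \<partial>P) \<le> (norm (G x))\<^sup>2 + \<sigma>\<^sup>2"
    using v(2) by (simp add: power2_norm_eq_inner)
qed

text \<open>\<open>K\<close> is the part of the energy that the step leaves alone, later the
  remaining noise budget. Nonnegativity of \<open>J\<close> is recorded because
  \<open>ennreal\<close> sends negative reals to 0, so the bound would not transfer back to real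
  arithmetic without it.\<close>

lemma stochastic_gradient_step:
  fixes f :: "'a::euclidean_space \<Rightarrow> real" and x z :: 'a
  assumes P: "prob_space P" and sg: "stochastic_gradient f P g \<sigma>"
    and sm: "L_smooth L f" and L: "L > 0" and mn: "\<And>y. f xs \<le> f y"
    and \<alpha>: "\<alpha> \<ge> 0" and \<beta>: "\<beta> \<ge> 0" and c: "\<beta> * c\<^sup>2 = \<alpha> / L" and K: "K \<ge> 0"
  defines "J \<equiv> \<alpha> * (f x - f xs) + \<beta> / 2 * (norm (z - xs))\<^sup>2 + K
      - \<beta> * c * inner (gradient f x) (z - xs) + \<sigma>\<^sup>2 * (\<alpha> / L)"
  shows "0 \<le> J" (is ?nonneg)
    and "(\<integral>\<^sup>+e. ennreal (\<alpha> * (f (x - (1 / L) *\<^sub>R g x e) - f xs)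
              + \<beta> / 2 * (norm (z - c *\<^sub>R g x e - xs))\<^sup>2 + K) \<partial>P) \<le> ennreal J" (is "?int \<le> _")
proof -
  interpret prob_space P by fact
  note mom = stochastic_gradient_moments[OF P sg]
  let ?G = "gradient f x"
  let ?v = "\<lambda>e. \<alpha> * (f (x - (1 / L) *\<^sub>R g x e) - f xs) + \<beta> / 2 * (norm (z - c *\<^sub>R g x e - xs))\<^sup>2 + K"
  \<comment> \<open>A majorant that is polynomial in the stochastic gradient: its mean follows from
    the first two moments, while \<open>f\<close> at the random point enters only through
    smoothness.\<close>
  define h where "h e = (\<alpha> * (f x - f xs) + \<beta> / 2 * (norm (z - xs))\<^sup>2 + K)
    - \<alpha> / L * inner (g x e) ?G - \<beta> * c * inner (g x e) (z - xs) + \<alpha> / L * (norm (g x e))\<^sup>2" for e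
  have v0: "0 \<le> ?v e" for e
    using \<alpha> \<beta> K mn by (intro add_nonneg_nonneg mult_nonneg_nonneg) auto
  have vh: "?v e \<le> h e" for e
  proof -
    have "f (x - (1 / L) *\<^sub>R g x e) \<le> f x + inner ?G (- ((1 / L) *\<^sub>R g x e)) + L / 2 * (norm ((1 / L) *\<^sub>R g x e))\<^sup>2"
      using sm[unfolded L_smooth_def, rule_format, of "x - (1 / L) *\<^sub>R g x e" x] by simp
    also have "\<dots> = f x - inner (g x e) ?G / L + (norm (g x e))\<^sup>2 / (2 * L)"
      using L by (simp add: power_mult_distrib inner_commute field_simps power2_eq_square)
    finally have 1: "f (x - (1 / L) *\<^sub>R g x e) - f xs \<le> f x - f xs - inner (g x e) ?G / L + (norm (g x e))\<^sup>2 / (2 * L)"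
      by simp
    have 2: "(norm (z - c *\<^sub>R g x e - xs))\<^sup>2 = (norm (z - xs))\<^sup>2 - 2 * c * inner (g x e) (z - xs) + c\<^sup>2 * (norm (g x e))\<^sup>2"
      unfolding power2_norm_eq_inner by (simp add: inner_diff inner_commute power2_eq_square algebra_simps)
    have "\<beta> / 2 * (norm (z - c *\<^sub>R g x e - xs))\<^sup>2
      = \<beta> / 2 * (norm (z - xs))\<^sup>2 - \<beta> * c * inner (g x e) (z - xs) + (\<beta> * c\<^sup>2) * (norm (g x e))\<^sup>2 / 2"
      unfolding 2 by (simp add: field_simps)
    then show ?thesis
      using mult_left_mono[OF 1 \<alpha>] unfolding h_def c by (simp add: algebra_simps)
  qed
  have hi: "integrable P h"
    unfolding h_def using mom by simp
  have "(\<integral>e. h e \<partial>P) = (\<alpha> * (f x - f xs) + \<beta> / 2 * (norm (z - xs))\<^sup>2 + K)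
    - \<alpha> / L * inner ?G ?G - \<beta> * c * inner ?G (z - xs) + \<alpha> / L * (\<integral>e. (norm (g x e))\<^sup>2 \<partial>P)"
    unfolding h_def using mom by (simp add: prob_space)
  also have "\<dots> \<le> (\<alpha> * (f x - f xs) + \<beta> / 2 * (norm (z - xs))\<^sup>2 + K)
    - \<alpha> / L * inner ?G ?G - \<beta> * c * inner ?G (z - xs) + \<alpha> / L * ((norm ?G)\<^sup>2 + \<sigma>\<^sup>2)"
    using mom(4) \<alpha> L by (intro add_left_mono mult_left_mono) auto
  also have "\<dots> = J"
    by (simp add: J_def power2_norm_eq_inner algebra_simps)
  finally have hJ: "(\<integral>e. h e \<partial>P) \<le> J" .
  have h0: "0 \<le> h e" for e using v0 vh by (rule order_trans)
  have "0 \<le> (\<integral>e. h e \<partial>P)" using h0 by simp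
  with hJ show ?nonneg by simp
  have "?int \<le> (\<integral>\<^sup>+e. ennreal (h e) \<partial>P)"
    by (intro nn_integral_mono ennreal_leI vh)
  also have "\<dots> = ennreal (\<integral>e. h e \<partial>P)"
    using hi h0 by (intro nn_integral_eq_integral) auto
  also have "\<dots> \<le> ennreal J" by (intro ennreal_leI hJ)
  finally show "?int \<le> ennreal J" .
qed

section \<open>The Lyapunov supermartingale\<close>

text \<open>
  Both parts of the theorem are instances of this locale. The functions \<open>a\<close> and \<open>b\<close> are the
  coefficients of the flow from time \<open>s\<close> to time \<open>t\<close>: it moves \<open>x\<close> by \<open>a s t\<close> times \<open>z - x\<close> and
  \<open>z\<close> by \<open>b s t\<close> times \<open>x - z\<close>. For \<open>\<eta> t = 2 / t\<close> the flow is singular at time 0, where it sends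
  \<open>x\<close> to \<open>z\<close> at once (\<open>a 0 0 = 1\<close>); this is harmless because \<open>A 0 = 0\<close> there.
\<close>
locale continuized_flow =
  fixes f :: "'a::euclidean_space \<Rightarrow> real" and g :: "'a \<Rightarrow> 'x \<Rightarrow> 'a" and P :: "'x measure"
    and L \<sigma> :: real and xs :: 'a
    and A A' B B' C \<eta> \<eta>' \<gamma>' :: "real \<Rightarrow> real" and a b :: "real \<Rightarrow> real \<Rightarrow> real"
  assumes P: "prob_space P" and sg: "stochastic_gradient f P g \<sigma>"
    and sm: "L_smooth L f" and L: "L > 0" and mn: "\<And>y. f xs \<le> f y"
    and df: "\<And>y. f differentiable (at y)"
    and A_pos: "\<And>t. t > 0 \<Longrightarrow> A t > 0" and A0: "A 0 \<ge> 0" and B0: "\<And>t. B t \<ge> 0"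
    and Bc: "\<And>t. t \<ge> 0 \<Longrightarrow> B t * (\<gamma>' t)\<^sup>2 = A t / L"
    and Cmono: "\<And>s t. 0 \<le> s \<Longrightarrow> s \<le> t \<Longrightarrow> C s \<le> C t"
    and contABC: "continuous_on UNIV A" "continuous_on UNIV B" "continuous_on UNIV C"
    and \<gamma>'_meas: "\<gamma>' \<in> borel_measurable borel"
    and derivABC: "\<And>t. t > 0 \<Longrightarrow> (A has_real_derivative A' t) (at t)"
      "\<And>t. t > 0 \<Longrightarrow> (B has_real_derivative B' t) (at t)"
      "\<And>t. t > 0 \<Longrightarrow> (C has_real_derivative A t / L) (at t)"
    and ab_meas: "(\<lambda>p. a (fst p) (snd p)) \<in> borel_measurable (borel \<Otimes>\<^sub>M borel)"
      "(\<lambda>p. b (fst p) (snd p)) \<in> borel_measurable (borel \<Otimes>\<^sub>M borel)"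
    and deriv_a: "\<And>s t. 0 \<le> s \<Longrightarrow> s < t \<Longrightarrow> (a s has_real_derivative \<eta> t * (1 - a s t - b s t)) (at t)"
    and deriv_b: "\<And>s t. 0 \<le> s \<Longrightarrow> s < t \<Longrightarrow> (b s has_real_derivative \<eta>' t * (1 - a s t - b s t)) (at t)"
    and cont_ab: "\<And>s. 0 \<le> s \<Longrightarrow> continuous_on {s..} (a s)" "\<And>s. 0 \<le> s \<Longrightarrow> continuous_on {s..} (b s)"
    and a_diag: "\<And>s. 0 \<le> s \<Longrightarrow> A s = 0 \<or> a s s = 0" and b_diag: "\<And>s. 0 \<le> s \<Longrightarrow> b s s = 0"
    and drift: "\<And>t x z. t > 0 \<Longrightarrow> A' t * (f x - f xs) + A t * \<eta> t * inner (gradient f x) (z - x)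
        + B' t / 2 * (norm (z - xs))\<^sup>2 + B t * \<eta>' t * inner (x - z) (z - xs)
        - B t * \<gamma>' t * inner (gradient f x) (z - xs) \<le> 0"
begin

definition X :: "real \<Rightarrow> real \<Rightarrow> 'a \<Rightarrow> 'a \<Rightarrow> 'a" where
  "X s t x z = x + a s t *\<^sub>R (z - x)"

definition Z :: "real \<Rightarrow> real \<Rightarrow> 'a \<Rightarrow> 'a \<Rightarrow> 'a" where
  "Z s t x z = z + b s t *\<^sub>R (x - z)"

definition energy :: "real \<Rightarrow> real \<Rightarrow> 'a \<Rightarrow> 'a \<Rightarrow> real" where
  "energy t s x z = A s * (f x - f xs) + B s / 2 * (norm (z - xs))\<^sup>2 + \<sigma>\<^sup>2 * (C t - C s)"

text \<open>Stopping is built into the transition: a wait that overshoots \<open>t\<close> only runs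
  the flow up to \<open>t\<close>, without a jump. For \<open>0 \<le> t\<close> and
  \<open>A t > 0\<close>, a state at time \<open>t\<close> is then fixed by every positive
  wait.\<close>

definition step :: "real \<Rightarrow> real \<times> 'a \<times> 'a \<Rightarrow> real \<Rightarrow> 'x \<Rightarrow> real \<times> 'a \<times> 'a" where
  "step t = (\<lambda>(s, x, z) r e.
     if s + r \<le> t
     then (s + r, X s (s + r) x z - (1 / L) *\<^sub>R g (X s (s + r) x z) e,
           Z s (s + r) x z - \<gamma>' (s + r) *\<^sub>R g (X s (s + r) x z) e)
     else (t, X s t x z, Z s t x z))"

text \<open>
  The noise budget of the whole interval \<open>[0, t]\<close> is included in \<^term>\<open>energy t\<close> to keep it
  nonnegative; the value \<open>\<infinity>\<close> outside \<open>[0, t]\<close> makes the supermartingale inequality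
  hold for every state.
\<close>
definition V :: "real \<Rightarrow> real \<times> 'a \<times> 'a \<Rightarrow> ennreal" where
  "V t = (\<lambda>(s, x, z). if 0 \<le> s \<and> s \<le> t then ennreal (energy t s x z) else \<infinity>)"

section \<open>The energy along the flow\<close>

lemma A_nonneg: "t \<ge> 0 \<Longrightarrow> A t \<ge> 0"
  using A_pos[of t] A0 by (cases "t = 0") auto

lemma energy_nonneg: "0 \<le> s \<Longrightarrow> s \<le> t \<Longrightarrow> 0 \<le> energy t s x z"
  unfolding energy_def using A_nonneg[of s] B0[of s] mn[of x] Cmono[of s t]
  by (intro add_nonneg_nonneg mult_nonneg_nonneg) auto

lemma f_cont: "continuous_on UNIV f"
  using df by (intro continuous_at_imp_continuous_on ballI differentiable_imp_continuous_within) auto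

lemma X_deriv:
  assumes "0 \<le> s" "s < t"
  shows "((\<lambda>t. X s t x z) has_vector_derivative \<eta> t *\<^sub>R (Z s t x z - X s t x z)) (at t)"
proof -
  have "((\<lambda>t. X s t x z) has_vector_derivative (\<eta> t * (1 - a s t - b s t)) *\<^sub>R (z - x)) (at t)"
    unfolding X_def using deriv_a[OF assms]
    by (auto intro!: derivative_eq_intros simp: has_real_derivative_iff_has_vector_derivative)
  also have "(\<eta> t * (1 - a s t - b s t)) *\<^sub>R (z - x) = \<eta> t *\<^sub>R (Z s t x z - X s t x z)"
    by (simp add: X_def Z_def algebra_simps)
  finally show ?thesis .
qed

lemma Z_deriv:
  assumes "0 \<le> s" "s < t"
  shows "((\<lambda>t. Z s t x z) has_vector_derivative \<eta>' t *\<^sub>R (X s t x z - Z s t x z)) (at t)"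
proof -
  have "((\<lambda>t. Z s t x z) has_vector_derivative (\<eta>' t * (1 - a s t - b s t)) *\<^sub>R (x - z)) (at t)"
    unfolding Z_def using deriv_b[OF assms]
    by (auto intro!: derivative_eq_intros simp: has_real_derivative_iff_has_vector_derivative)
  also have "(\<eta>' t * (1 - a s t - b s t)) *\<^sub>R (x - z) = \<eta>' t *\<^sub>R (X s t x z - Z s t x z)"
    by (simp add: X_def Z_def algebra_simps)
  finally show ?thesis .
qed

lemma energy_flow_deriv:
  assumes "0 \<le> s" "s < \<tau>"
  shows "((\<lambda>\<tau>. energy t \<tau> (X s \<tau> x z) (Z s \<tau> x z)) has_real_derivative
    A' \<tau> * (f (X s \<tau> x z) - f xs)
      + A \<tau> * \<eta> \<tau> * inner (gradient f (X s \<tau> x z)) (Z s \<tau> x z - X s \<tau> x z)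
      + B' \<tau> / 2 * (norm (Z s \<tau> x z - xs))\<^sup>2
      + B \<tau> * \<eta>' \<tau> * inner (X s \<tau> x z - Z s \<tau> x z) (Z s \<tau> x z - xs)
      - \<sigma>\<^sup>2 * (A \<tau> / L)) (at \<tau>)"
proof -
  let ?X = "\<lambda>\<tau>. X s \<tau> x z" and ?Z = "\<lambda>\<tau>. Z s \<tau> x z"
  have "(f has_derivative (\<lambda>h. inner h (gradient f (?X \<tau>)))) (at (?X \<tau>))"
    using GDERIV_gradient[OF df] by (simp add: gderiv_def)
  then have "((\<lambda>\<tau>. f (?X \<tau>)) has_derivative
      (\<lambda>h. inner (h *\<^sub>R \<eta> \<tau> *\<^sub>R (?Z \<tau> - ?X \<tau>)) (gradient f (?X \<tau>)))) (at \<tau>)"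
    using X_deriv[OF assms, of x z] unfolding has_vector_derivative_def
    by (rule has_derivative_compose[rotated])
  then have 1: "((\<lambda>\<tau>. f (?X \<tau>)) has_real_derivative
      \<eta> \<tau> * inner (gradient f (?X \<tau>)) (?Z \<tau> - ?X \<tau>)) (at \<tau>)"
    by (simp add: has_field_derivative_def inner_commute mult_commute_abs mult.assoc)
  have Zd: "(?Z has_derivative (\<lambda>h. h *\<^sub>R \<eta>' \<tau> *\<^sub>R (?X \<tau> - ?Z \<tau>))) (at \<tau>)"
    using Z_deriv[OF assms, of x z] unfolding has_vector_derivative_def .
  have "((\<lambda>\<tau>. inner (?Z \<tau> - xs) (?Z \<tau> - xs)) has_derivative
      (\<lambda>h. h * (2 * (\<eta>' \<tau> * inner (?X \<tau> - ?Z \<tau>) (?Z \<tau> - xs))))) (at \<tau>)"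
    by (rule derivative_eq_intros Zd refl)+ (auto simp: fun_eq_iff inner_commute algebra_simps)
  then have 2: "((\<lambda>\<tau>. (norm (?Z \<tau> - xs))\<^sup>2) has_real_derivative
      2 * (\<eta>' \<tau> * inner (?X \<tau> - ?Z \<tau>) (?Z \<tau> - xs))) (at \<tau>)"
    by (simp add: has_field_derivative_def power2_norm_eq_inner mult_commute_abs)
  have "\<tau> > 0" using assms by simp
  note d = derivABC[OF this]
  have gen: "((\<lambda>\<tau>. A \<tau> * (F \<tau> - f xs) + B \<tau> / 2 * N \<tau> + \<sigma>\<^sup>2 * (C t - C \<tau>)) has_real_derivative
      A' \<tau> * (F \<tau> - f xs) + A \<tau> * F' + B' \<tau> / 2 * N \<tau> + B \<tau> / 2 * N' - \<sigma>\<^sup>2 * (A \<tau> / L)) (at \<tau>)"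
    if "(F has_real_derivative F') (at \<tau>)" "(N has_real_derivative N') (at \<tau>)" for F N F' N'
    using that d by (auto intro!: derivative_eq_intros simp: algebra_simps)
  show ?thesis
    unfolding energy_def by (rule DERIV_cong[OF gen[OF 1 2]]) (simp add: algebra_simps)
qed

lemma energy_flow_cont:
  assumes "0 \<le> s"
  shows "continuous_on {s..} (\<lambda>\<tau>. energy t \<tau> (X s \<tau> x z) (Z s \<tau> x z))"
proof -
  have X: "continuous_on {s..} (\<lambda>\<tau>. X s \<tau> x z)" and "continuous_on {s..} (\<lambda>\<tau>. Z s \<tau> x z)"
    unfolding X_def Z_def using cont_ab[OF assms] by (auto intro!: continuous_intros)
  moreover have "continuous_on {s..} (\<lambda>\<tau>. f (X s \<tau> x z))"
    using continuous_on_compose2[OF f_cont X] by auto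
  moreover have "continuous_on {s..} A" "continuous_on {s..} B" "continuous_on {s..} C"
    using contABC by (auto intro: continuous_on_subset)
  ultimately show ?thesis
    unfolding energy_def by (auto intro!: continuous_intros)
qed

text \<open>Where the flow does not start at the identity, \<open>a_diag\<close> gives
  \<open>A s = 0\<close>, so the displaced \<open>x\<close> enters the energy with weight
  zero.\<close>

lemma energy_flow_start:
  assumes "0 \<le> s"
  shows "energy t s (X s s x z) (Z s s x z) = energy t s x z"
  using a_diag[OF assms] b_diag[OF assms] by (auto simp: energy_def X_def Z_def)

section \<open>Measurability of the energy and of the step\<close>

lemma V_meas: "V t \<in> borel_measurable borel"
proof -
  have [measurable]: "f \<in> borel_measurable borel" "A \<in> borel_measurable borel"
    "B \<in> borel_measurable borel" "C \<in> borel_measurable borel"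
    using f_cont contABC by (auto intro: borel_measurable_continuous_onI)
  have "V t \<in> borel_measurable (borel \<Otimes>\<^sub>M (borel \<Otimes>\<^sub>M borel))"
    unfolding V_def energy_def case_prod_beta' by measurable
  then show ?thesis by (simp add: borel_prod)
qed

lemma step_meas:
  "(\<lambda>(s, r, e). step t s r e) \<in> borel \<Otimes>\<^sub>M (exp_measure \<Otimes>\<^sub>M P) \<rightarrow>\<^sub>M borel"
proof -
  note [measurable] = \<gamma>'_meas
  have gm: "(\<lambda>(x, \<xi>). g x \<xi>) \<in> borel_measurable (borel \<Otimes>\<^sub>M P)"
    using sg by (simp add: stochastic_gradient_def)
  have [measurable (raw)]: "(\<lambda>w. g (p w) (q w)) \<in> borel_measurable K"
    if "p \<in> borel_measurable K" "q \<in> K \<rightarrow>\<^sub>M P" for p q and K :: "'z measure"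
    using measurable_compose[OF measurable_Pair[OF that] gm] by simp
  have [measurable (raw)]: "(\<lambda>w. a (p w) (q w)) \<in> borel_measurable K"
    "(\<lambda>w. b (p w) (q w)) \<in> borel_measurable K"
    if "p \<in> borel_measurable K" "q \<in> borel_measurable K" for p q and K :: "'z measure"
    using measurable_compose[OF measurable_Pair[OF that] ab_meas(1)]
      measurable_compose[OF measurable_Pair[OF that] ab_meas(2)] by simp_all
  have "(\<lambda>(s, r, e). step t s r e) \<in> (borel \<Otimes>\<^sub>M (borel \<Otimes>\<^sub>M borel)) \<Otimes>\<^sub>M (borel \<Otimes>\<^sub>M P) \<rightarrow>\<^sub>M borel"
    unfolding step_def X_def Z_def case_prod_beta' by measurable
  moreover have "sets (borel \<Otimes>\<^sub>M (exp_measure \<Otimes>\<^sub>M P)) =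
      sets ((borel \<Otimes>\<^sub>M (borel \<Otimes>\<^sub>M borel)) \<Otimes>\<^sub>M (borel \<Otimes>\<^sub>M P) :: ((real \<times> 'a \<times> 'a) \<times> real \<times> 'x) measure)"
    unfolding borel_prod by (intro sets_pair_measure_cong) auto
  ultimately show ?thesis
    using measurable_cong_sets[OF _ refl] by blast
qed

text \<open>This is the generator inequality (mean after the jump, minus \<open>U\<close>, plus the
  drift \<open>D\<close>, is at most 0), arranged so that its right side becomes a total derivative
  under the weight \<open>exp (- r)\<close>. The budget \<open>C\<close> has derivative
  \<open>A / L\<close>, so its consumption in \<open>D\<close> pays exactly for the noise created by
  the jump.\<close>

lemma V_jump_le:
  fixes x z :: "'a"
  assumes "0 \<le> s" "0 < r" "s + r \<le> t"
  defines "U \<equiv> \<lambda>\<tau>. energy t \<tau> (X s \<tau> x z) (Z s \<tau> x z)"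
  obtains D where "(U has_real_derivative D) (at (s + r))" "0 \<le> U (s + r) - D"
    "(\<integral>\<^sup>+e. V t (step t (s, x, z) r e) \<partial>P) \<le> ennreal (U (s + r) - D)"
proof -
  let ?\<tau> = "s + r" and ?x = "X s (s + r) x z" and ?z = "Z s (s + r) x z"
  have \<tau>: "?\<tau> > 0" "0 \<le> ?\<tau>" "s < ?\<tau>" using assms by auto
  define D where "D = A' ?\<tau> * (f ?x - f xs) + A ?\<tau> * \<eta> ?\<tau> * inner (gradient f ?x) (?z - ?x)
      + B' ?\<tau> / 2 * (norm (?z - xs))\<^sup>2 + B ?\<tau> * \<eta>' ?\<tau> * inner (?x - ?z) (?z - xs) - \<sigma>\<^sup>2 * (A ?\<tau> / L)"
  have D: "(U has_real_derivative D) (at ?\<tau>)"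
    unfolding U_def D_def by (rule energy_flow_deriv) fact+
  have K: "0 \<le> \<sigma>\<^sup>2 * (C t - C ?\<tau>)"
    using Cmono[OF \<tau>(2)] assms by simp
  note J = stochastic_gradient_step[OF P sg sm L mn A_nonneg[OF \<tau>(2)] B0 Bc[OF \<tau>(2)] K, of ?x ?z]
  let ?J = "A ?\<tau> * (f ?x - f xs) + B ?\<tau> / 2 * (norm (?z - xs))\<^sup>2 + \<sigma>\<^sup>2 * (C t - C ?\<tau>)
    - B ?\<tau> * \<gamma>' ?\<tau> * inner (gradient f ?x) (?z - xs) + \<sigma>\<^sup>2 * (A ?\<tau> / L)"
  have JD: "?J \<le> U ?\<tau> - D"
    using drift[OF \<tau>(1), of ?x ?z] unfolding U_def energy_def D_def by linarith
  have "(\<integral>\<^sup>+e. V t (step t (s, x, z) r e) \<partial>P) \<le> ennreal ?J"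
    using J(2) assms by (simp add: V_def step_def energy_def)
  also have "\<dots> \<le> ennreal (U ?\<tau> - D)" by (rule ennreal_leI[OF JD])
  finally show ?thesis using D JD J(1) by (intro that[of D]) auto
qed

text \<open>Split by the first wait \<open>r\<close> against the remaining time \<open>R\<close>.
  For \<open>0 < r < R\<close> the integrand is at most the derivative of
  \<open>- exp (- r) * U (s + r)\<close>, which integrates to \<open>U s - exp (- R) * U t\<close>.
  Overshooting has probability \<open>exp (- R)\<close> and leaves energy \<open>U t\<close>, so the
  pieces add up to \<open>U s\<close>.\<close>

lemma V_supermartingale_step:
  "(\<integral>\<^sup>+r. \<integral>\<^sup>+e. V t (step t w r e) \<partial>P \<partial>exp_measure) \<le> V t w"
proof -
  obtain s x z where w: "w = (s, x, z)" by (cases w)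
  show ?thesis
  proof (cases "0 \<le> s \<and> s \<le> t")
    case False
    then show ?thesis by (auto simp: V_def w)
  next
    case True
    then have st: "0 \<le> s" "s \<le> t" by auto
    interpret P: prob_space P by (rule P)
    define R where "R = t - s"
    define U where "U \<tau> = energy t \<tau> (X s \<tau> x z) (Z s \<tau> x z)" for \<tau>
    define h where "h r = (\<integral>\<^sup>+e. V t (step t w r e) \<partial>P)" for r
    have R: "0 \<le> R" using st by (simp add: R_def)
    have [measurable]: "h \<in> borel_measurable borel"
    proof -
      have "(\<lambda>(r, e). V t (step t w r e)) \<in> borel_measurable (exp_measure \<Otimes>\<^sub>M P)"
        using measurable_compose[OF measurable_compose[OF measurable_Pair1' step_meas] V_meas, of w]
        by (simp add: case_prod_beta')
      then have "h \<in> borel_measurable exp_measure"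
        unfolding h_def by (rule P.borel_measurable_nn_integral)
      then show ?thesis by simp
    qed
    have ex: "\<exists>D. (U has_real_derivative D) (at (s + r)) \<and> 0 \<le> U (s + r) - D \<and> h r \<le> ennreal (U (s + r) - D)"
      if "r \<in> {0<..<R}" for r
    proof -
      have r: "0 < r" "s + r \<le> t" using that by (auto simp: R_def)
      show ?thesis
        by (rule V_jump_le[OF st(1) r, of x z]) (auto simp: U_def[abs_def] h_def w)
    qed
    then obtain D where D: "\<And>r. r \<in> {0<..<R} \<Longrightarrow> (U has_real_derivative D r) (at (s + r))"
      "\<And>r. r \<in> {0<..<R} \<Longrightarrow> 0 \<le> U (s + r) - D r"
      "\<And>r. r \<in> {0<..<R} \<Longrightarrow> h r \<le> ennreal (U (s + r) - D r)"
      by metis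
    define G where "G r = - exp (- r) * U (s + r)" for r
    have Gc: "continuous_on {0..R} G"
    proof -
      have "continuous_on {0..R} (\<lambda>r. U (s + r))"
        unfolding U_def using st
        by (intro continuous_on_compose2[OF energy_flow_cont[OF st(1)]]) (auto intro!: continuous_intros)
      then show ?thesis unfolding G_def by (auto intro!: continuous_intros)
    qed
    have Gd: "(G has_vector_derivative exp (- r) * (U (s + r) - D r)) (at r)" if "r \<in> {0<..<R}" for r
    proof -
      have "((\<lambda>r. U (s + r)) has_real_derivative D r) (at r)"
        using D(1)[OF that] DERIV_shift[of U "D r" r s] by (simp add: add.commute)
      then have "(G has_real_derivative exp (- r) * (U (s + r) - D r)) (at r)"
        unfolding G_def by (auto intro!: derivative_eq_intros simp: algebra_simps)
      then show ?thesis by (simp add: has_real_derivative_iff_has_vector_derivative)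
    qed
    \<comment> \<open>Differentiability is available only in the interior, since at
      \<open>s = 0\<close> the flow may start with the singular rate \<open>2 / t\<close>;
      continuity covers the endpoints.\<close>
    have "((\<lambda>r. exp (- r) * (U (s + r) - D r)) has_integral G R - G 0) {0..R}"
      by (rule fundamental_theorem_of_calculus_interior[OF R Gc Gd])
    then have Gi: "((\<lambda>r. exp (- r) * (U (s + r) - D r)) has_integral G R - G 0) {0<..<R}"
      by (simp add: has_integral_Icc_iff_Ioo)
    have Gnn: "0 \<le> G R - G 0"
      by (rule has_integral_nonneg[OF Gi]) (use D(2) in auto)
    have part1: "(\<integral>\<^sup>+r. ennreal (exp (- r)) * h r * indicator {0<..<R} r \<partial>lborel) \<le> ennreal (G R - G 0)"
    proof -
      have "(\<integral>\<^sup>+r. ennreal (exp (- r)) * h r * indicator {0<..<R} r \<partial>lborel)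
          \<le> (\<integral>\<^sup>+r. ennreal (indicator {0<..<R} r * (exp (- r) * (U (s + r) - D r))) \<partial>lborel)"
      proof (rule nn_integral_mono)
        fix r :: real
        show "ennreal (exp (- r)) * h r * indicator {0<..<R} r
            \<le> ennreal (indicator {0<..<R} r * (exp (- r) * (U (s + r) - D r)))"
          using mult_left_mono[OF D(3)[of r], of "ennreal (exp (- r))"] D(2)[of r]
          by (auto simp: ennreal_mult split: split_indicator)
      qed
      also have "\<dots> = ennreal (G R - G 0)"
        using D(2) by (intro nn_integral_has_integral_lebesgue[OF _ Gi]) auto
      finally show ?thesis .
    qed
    have UR: "0 \<le> U t" unfolding U_def using st by (intro energy_nonneg) auto
    have part2: "(\<integral>\<^sup>+r. ennreal (exp (- r)) * h r * indicator {R<..} r \<partial>lborel) \<le> ennreal (exp (- R) * U t)"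
    proof -
      have "(\<integral>\<^sup>+r. ennreal (exp (- r)) * h r * indicator {R<..} r \<partial>lborel)
          \<le> (\<integral>\<^sup>+r. ennreal (exp (- r) * U t) * indicator {R..} r \<partial>lborel)"
      proof (rule nn_integral_mono)
        fix r :: real
        have "h r = ennreal (U t)" if "r > R"
        proof -
          have "\<not> s + r \<le> t" using that by (simp add: R_def)
          then show ?thesis using st
            by (simp add: h_def w step_def V_def U_def P.emeasure_space_1)
        qed
        then show "ennreal (exp (- r)) * h r * indicator {R<..} r
            \<le> ennreal (exp (- r) * U t) * indicator {R..} r"
          using UR by (auto simp: ennreal_mult split: split_indicator)
      qed
      also have "\<dots> = ennreal (0 - (- exp (- R) * U t))"
      proof (rule nn_integral_FTC_atLeast)
        show "((\<lambda>r. - exp (- r) * U t) \<longlongrightarrow> 0) at_top"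
          by (intro tendsto_mult_left_zero tendsto_minus_cancel_left[THEN iffD1])
            (auto intro!: tendsto_eq_intros filterlim_compose[OF exp_at_bot] filterlim_uminus_at_bot_at_top)
      qed (use UR in \<open>auto intro!: derivative_eq_intros\<close>)
      finally show ?thesis by simp
    qed
    have "(\<integral>\<^sup>+r. h r \<partial>exp_measure) = (\<integral>\<^sup>+r. ennreal (exp (- r)) * h r * indicator {0..} r \<partial>lborel)"
      by (rule nn_integral_exp_measure) measurable
    also have "\<dots> = (\<integral>\<^sup>+r. ennreal (exp (- r)) * h r * indicator {0<..<R} r
        + ennreal (exp (- r)) * h r * indicator {R<..} r \<partial>lborel)"
    proof (rule nn_integral_cong_AE)
      \<comment> \<open>The endpoints \<open>0\<close> and \<open>R\<close> belong to neither piece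
        but form a null set.\<close>
      have "AE r in lborel. r \<noteq> (0::real)" "AE r in lborel. r \<noteq> R"
        by (rule AE_lborel_singleton)+
      then show "AE r in lborel. ennreal (exp (- r)) * h r * indicator {0..} r
         = ennreal (exp (- r)) * h r * indicator {0<..<R} r + ennreal (exp (- r)) * h r * indicator {R<..} r"
        by eventually_elim (use R in \<open>auto split: split_indicator\<close>)
    qed
    also have "\<dots> = (\<integral>\<^sup>+r. ennreal (exp (- r)) * h r * indicator {0<..<R} r \<partial>lborel)
        + (\<integral>\<^sup>+r. ennreal (exp (- r)) * h r * indicator {R<..} r \<partial>lborel)"
      by (rule nn_integral_add) measurable
    also have "\<dots> \<le> ennreal (G R - G 0) + ennreal (exp (- R) * U t)"
      by (intro add_mono part1 part2)
    also have "\<dots> = ennreal (U s)"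
      using Gnn UR by (subst ennreal_plus[symmetric]) (auto simp: G_def R_def)
    also have "\<dots> = V t w"
      using st energy_flow_start[OF st(1)] by (simp add: V_def w U_def)
    finally show ?thesis by (simp add: h_def)
  qed
qed

text \<open>A statement about a single path. Input \<open>n\<close> of the chain is the wait leading
  to jump \<open>Suc n\<close> together with the mark of that jump.\<close>

lemma chain_step_eq_path:
  assumes T: "T 0 = 0" "\<And>k. T k < T (Suc k)"
    and path: "continuized_path T \<xi> g \<eta> \<eta>' (\<lambda>t. 1 / L) \<gamma>' x0 z0 x z"
    and flow: "\<And>k t. t \<in> {T k<..<T (Suc k)} \<Longrightarrow>
      x t = X (T k) t (x (T k)) (z (T k)) \<and> z t = Z (T k) t (x (T k)) (z (T k))"
    and t: "0 \<le> t" "A t > 0"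
  shows "chain (step t) (0, x0, z0) (\<lambda>k. T (Suc k) - T k) (\<lambda>k. \<xi> (Suc k)) n
    = (if T n \<le> t then (T n, x (T n), z (T n)) else (t, x t, z t))"
proof (induction n)
  case 0
  show ?case using T path t by (simp add: continuized_path_def)
next
  case (Suc n)
  have T0: "0 \<le> T n" for n
    using lift_Suc_mono_le[of T 0 n] T by (simp add: less_imp_le)
  \<comment> \<open>Here \<open>A t > 0\<close> excludes the singular start of the flow, so a
    stopped state stays put.\<close>
  have diag: "X t t u v = u" "Z t t u v = v" for u v
    using a_diag[OF t(1)] b_diag[OF t(1)] t(2) by (auto simp: X_def Z_def)
  have left_lim_eq: "left_lim y (T (Suc n)) = F (T (Suc n))"
    if F: "(F has_vector_derivative D) (at (T (Suc n)))"
      and eq: "\<And>t. t \<in> {T n<..<T (Suc n)} \<Longrightarrow> y t = F t" for y F :: "real \<Rightarrow> 'a" and D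
  proof -
    have "(F \<longlongrightarrow> F (T (Suc n))) (at_left (T (Suc n)))"
      using has_vector_derivative_continuous[OF F] by (simp add: isCont_def filterlim_at_split)
    moreover have "\<forall>\<^sub>F t in at_left (T (Suc n)). F t = y t"
      using eventually_at_left_real[OF T(2)[of n]] by eventually_elim (simp add: eq)
    ultimately have "(y \<longlongrightarrow> F (T (Suc n))) (at_left (T (Suc n)))"
      by (rule Lim_transform_eventually)
    then show ?thesis unfolding left_lim_def by (rule tendsto_Lim[rotated]) simp
  qed
  have lim: "left_lim x (T (Suc n)) = X (T n) (T (Suc n)) (x (T n)) (z (T n))"
    by (rule left_lim_eq[OF X_deriv[OF T0 T(2)]]) (use flow in auto)
  have limz: "left_lim z (T (Suc n)) = Z (T n) (T (Suc n)) (x (T n)) (z (T n))"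
    by (rule left_lim_eq[OF Z_deriv[OF T0 T(2)]]) (use flow in auto)
  have jump: "x (T (Suc n)) = left_lim x (T (Suc n)) - (1 / L) *\<^sub>R g (left_lim x (T (Suc n))) (\<xi> (Suc n))"
    "z (T (Suc n)) = left_lim z (T (Suc n)) - \<gamma>' (T (Suc n)) *\<^sub>R g (left_lim x (T (Suc n))) (\<xi> (Suc n))"
    using path by (auto simp: continuized_path_def)
  have Tn: "T n < T (Suc n)" by (rule T)
  \<comment> \<open>\<open>T n = t\<close> stands apart because \<open>flow\<close> speaks only of
    the open interval; there the step is trivial by \<open>diag\<close>.\<close>
  consider "T (Suc n) \<le> t" | "T n = t" | "T n < t" "t < T (Suc n)" | "t < T n" by linarith
  then show ?case
  proof cases
    case 1
    then show ?thesis using Suc Tn jump by (simp add: step_def lim limz)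
  next
    case 2
    then show ?thesis using Suc Tn diag by (auto simp: step_def)
  next
    case 3
    then show ?thesis using Suc flow[of t n] by (auto simp: step_def)
  next
    case 4
    then show ?thesis using Suc Tn diag by (auto simp: step_def)
  qed
qed

text \<open>Almost every path has a jump after \<open>t\<close>, from which index on the chain rests
  at \<open>(t, x t, z t)\<close>. Its limit energy is therefore the energy at time
  \<open>t\<close>, and Fatou passes the bound to it. The hypothesis \<open>flow\<close> ranges over
  all paths so that it can be applied to each outcome separately.\<close>

lemma expectation_bound:
  assumes M: "prob_space M" and PA: "poisson_atoms M P T \<xi>"
    and proc: "continuized_process M T \<xi> g \<eta> \<eta>' (\<lambda>t. 1 / L) \<gamma>' x0 z0 x z"
    and flow: "\<And>T \<xi> x z k t. continuized_path T \<xi> g \<eta> \<eta>' (\<lambda>t. 1 / L) \<gamma>' x0 z0 x z \<Longrightarrow>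
      0 \<le> T k \<Longrightarrow> t \<in> {T k<..<T (Suc k)} \<Longrightarrow>
      x t = X (T k) t (x (T k)) (z (T k)) \<and> z t = Z (T k) t (x (T k)) (z (T k))"
    and t: "0 \<le> t" "A t > 0"
  shows "integrable M (\<lambda>\<omega>. f (x t \<omega>))"
    and "(\<integral>\<omega>. f (x t \<omega>) \<partial>M) - f xs \<le> energy t 0 x0 z0 / A t"
proof -
  interpret prob_space M by fact
  have [measurable]: "random_variable borel (x t)" "random_variable borel (z t)"
    using proc t by (auto simp: continuized_process_def)
  have [measurable]: "f \<in> borel_measurable borel"
    using f_cont by (rule borel_measurable_continuous_onI)
  let ?w = "\<lambda>n \<omega>. chain (step t) (0, x0, z0) (\<lambda>k. T (Suc k) \<omega> - T k \<omega>) (\<lambda>k. \<xi> (Suc k) \<omega>) n"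
  have ev: "AE \<omega> in M. (\<lambda>n. V t (?w n \<omega>)) \<longlonglongrightarrow> V t (t, x t \<omega>, z t \<omega>)"
    using poisson_atoms_increasing[OF M PA] poisson_atoms_unbounded[OF M PA, of t]
      proc[unfolded continuized_process_def, THEN conjunct2]
  proof eventually_elim
    case (elim \<omega>)
    have mono: "T m \<omega> \<le> T n \<omega>" if "m \<le> n" for m n
      using lift_Suc_mono_le[of "\<lambda>k. T k \<omega>" m n] that elim(1) by (auto intro: less_imp_le)
    obtain k where k: "t < T k \<omega>" using elim(2) by auto
    have w: "?w n \<omega> = (if T n \<omega> \<le> t then (T n \<omega>, x (T n \<omega>) \<omega>, z (T n \<omega>) \<omega>) else (t, x t \<omega>, z t \<omega>))" for n
    proof (rule chain_step_eq_path[where x="\<lambda>t. x t \<omega>" and z="\<lambda>t. z t \<omega>"])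
      fix k u assume "u \<in> {T k \<omega><..<T (Suc k) \<omega>}"
      then show "x u \<omega> = X (T k \<omega>) u (x (T k \<omega>) \<omega>) (z (T k \<omega>) \<omega>)
          \<and> z u \<omega> = Z (T k \<omega>) u (x (T k \<omega>) \<omega>) (z (T k \<omega>) \<omega>)"
        using flow[OF elim(3), of k u] mono[of 0 k] elim(1) by auto
    qed (use elim t in auto)
    have "?w n \<omega> = (t, x t \<omega>, z t \<omega>)" if "n \<ge> k" for n
      using mono[OF that] k w[of n] by auto
    then have "\<forall>\<^sub>F n in sequentially. V t (t, x t \<omega>, z t \<omega>) = V t (?w n \<omega>)"
      by (auto simp: eventually_sequentially intro!: exI[of _ k])
    then show ?case by (rule Lim_transform_eventually[OF tendsto_const])
  qed
  have "(\<integral>\<^sup>+\<omega>. V t (t, x t \<omega>, z t \<omega>) \<partial>M) = (\<integral>\<^sup>+\<omega>. liminf (\<lambda>n. V t (?w n \<omega>)) \<partial>M)"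
    using ev by (intro nn_integral_cong_AE) (auto dest!: lim_imp_Liminf[rotated])
  also have "\<dots> \<le> V t (0, x0, z0)"
  proof -
    let ?Q = "(\<Pi>\<^sub>M i\<in>(UNIV::nat set). exp_measure) \<Otimes>\<^sub>M (\<Pi>\<^sub>M i\<in>(UNIV::nat set). P)"
    have hm: "(\<lambda>p. V t (chain (step t) (0, x0, z0) (fst p) (snd p) n)) \<in> borel_measurable ?Q" for n
      using measurable_compose[OF measurable_compose[OF measurable_Pair1' measurable_chain[OF step_meas[of t], of n]] V_meas[of t],
          of "(0, x0, z0)"] by (simp add: case_prod_beta')
    note I = nn_integral_poisson_atoms[OF M P PA hm]
    have wm: "(\<lambda>\<omega>. V t (?w n \<omega>)) \<in> borel_measurable M" for n
      using measurable_compose[OF I(1) hm] by simp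
    have "(\<integral>\<^sup>+\<omega>. liminf (\<lambda>n. V t (?w n \<omega>)) \<partial>M) \<le> liminf (\<lambda>n. \<integral>\<^sup>+\<omega>. V t (?w n \<omega>) \<partial>M)"
      by (rule nn_integral_liminf[OF wm])
    also have "\<dots> \<le> V t (0, x0, z0)"
    proof -
      have "(\<integral>\<^sup>+\<omega>. V t (?w n \<omega>) \<partial>M) \<le> V t (0, x0, z0)" for n
        using chain_supermartingale[OF prob_space_exponential_density[of 1] P step_meas V_meas
            V_supermartingale_step, of "(0, x0, z0)" t n] I(2)[of n] by simp
      then show ?thesis
        by (intro Liminf_le) auto
    qed
    finally show ?thesis .
  qed
  finally have le: "(\<integral>\<^sup>+\<omega>. V t (t, x t \<omega>, z t \<omega>) \<partial>M) \<le> ennreal (energy t 0 x0 z0)"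
    using t by (simp add: V_def)
  \<comment> \<open>At time \<open>t\<close> the noise budget is exhausted and the \<open>B\<close>
    term is nonnegative, so the energy dominates the gap in \<open>f\<close>.\<close>
  have "(\<integral>\<^sup>+\<omega>. ennreal (A t * (f (x t \<omega>) - f xs)) \<partial>M) \<le> (\<integral>\<^sup>+\<omega>. V t (t, x t \<omega>, z t \<omega>) \<partial>M)"
    using t B0[of t] by (intro nn_integral_mono) (auto simp: V_def energy_def intro!: ennreal_leI)
  with le have le': "(\<integral>\<^sup>+\<omega>. ennreal (A t * (f (x t \<omega>) - f xs)) \<partial>M) \<le> ennreal (energy t 0 x0 z0)"
    by simp
  \<comment> \<open>The finite nonnegative integral yields integrability, and only now may Bochner
    integrals be used.\<close>
  have i: "integrable M (\<lambda>\<omega>. A t * (f (x t \<omega>) - f xs))"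
    using le' t mn by (intro integrableI_nonneg) (auto simp: less_top[symmetric] top_unique)
  then have i': "integrable M (\<lambda>\<omega>. f (x t \<omega>) - f xs)"
    using t by simp
  then have "integrable M (\<lambda>\<omega>. (f (x t \<omega>) - f xs) + f xs)"
    by (intro Bochner_Integration.integrable_add) auto
  then show int: "integrable M (\<lambda>\<omega>. f (x t \<omega>))" by simp
  have "ennreal (\<integral>\<omega>. A t * (f (x t \<omega>) - f xs) \<partial>M) \<le> ennreal (energy t 0 x0 z0)"
    using le' t mn by (subst nn_integral_eq_integral[OF i, symmetric]) auto
  then have "(\<integral>\<omega>. A t * (f (x t \<omega>) - f xs) \<partial>M) \<le> energy t 0 x0 z0"
    using energy_nonneg[of 0 t] t by simp
  then have "A t * ((\<integral>\<omega>. f (x t \<omega>) \<partial>M) - f xs) \<le> energy t 0 x0 z0"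
    using int by (simp add: prob_space)
  then show "(\<integral>\<omega>. f (x t \<omega>) \<partial>M) - f xs \<le> energy t 0 x0 z0 / A t"
    using t by (simp add: pos_le_divide_eq mult.commute)
qed

end

section \<open>Paths follow the flow\<close>

text \<open>The differential equations hold only between jumps, so a conserved quantity has to be
  matched with its value at the jump through right continuity.\<close>

lemma zero_derivative_Ioo_eq_limit:
  fixes q :: "real \<Rightarrow> 'a::real_normed_vector"
  assumes d: "\<And>t. t \<in> {s<..<e} \<Longrightarrow> (q has_vector_derivative 0) (at t)"
    and l: "(q \<longlongrightarrow> l) (at_right s)" and t: "t \<in> {s<..<e}"
  shows "q t = l"
proof -
  have "\<exists>c. \<forall>u\<in>{s<..<e}. q u = c"
    using d by (intro has_derivative_zero_constant)
      (auto simp: has_vector_derivative_def intro: has_derivative_at_withinI)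
  then obtain c where c: "\<And>u. u \<in> {s<..<e} \<Longrightarrow> q u = c" by blast
  have "\<forall>\<^sub>F u in at_right s. q u = c"
    using eventually_at_right_real[of s e] t by (auto elim!: eventually_mono intro: c)
  then have "(q \<longlongrightarrow> c) (at_right s)" by (rule tendsto_eventually)
  then have "c = l" using l by (rule tendsto_unique[rotated]) simp
  then show ?thesis using c[OF t] by simp
qed

text \<open>With \<open>z\<close> frozen, \<open>t^2\<close> is an integrating factor for
  \<open>x' = (2 / t) (z - x)\<close>, so \<open>t^2 (x - z)\<close> is conserved. For
  \<open>T k = 0\<close> this forces \<open>x t = z (T k)\<close>, the instantaneous collapse at the
  singular time.\<close>

lemma continuized_path_flow_convex:
  fixes x z :: "real \<Rightarrow> 'a::euclidean_space"
  assumes p: "continuized_path T \<xi> g (\<lambda>t. 2 / t) (\<lambda>t. 0) \<gamma> \<gamma>' x0 z0 x z"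
    and T: "0 \<le> T k" and t: "t \<in> {T k<..<T (Suc k)}"
  shows "x t = x (T k) + (1 - (T k / t)\<^sup>2) *\<^sub>R (z (T k) - x (T k)) \<and> z t = z (T k)"
proof -
  let ?s = "T k"
  have cx: "(x \<longlongrightarrow> x ?s) (at_right ?s)" and cz: "(z \<longlongrightarrow> z ?s) (at_right ?s)"
    using p T by (auto simp: continuized_path_def cadlag_def)
  have dx: "(x has_vector_derivative (2 / u) *\<^sub>R (z u - x u)) (at u)"
    and dz: "(z has_vector_derivative 0) (at u)" if "u \<in> {?s<..<T (Suc k)}" for u
    using p that by (auto simp: continuized_path_def)
  have z: "z t = z ?s" if "t \<in> {?s<..<T (Suc k)}" for t
    using zero_derivative_Ioo_eq_limit[OF dz cz that] .
  have "t\<^sup>2 *\<^sub>R (x t - z ?s) = ?s\<^sup>2 *\<^sub>R (x ?s - z ?s)"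
  proof (rule zero_derivative_Ioo_eq_limit[OF _ _ t, where q="\<lambda>t. t\<^sup>2 *\<^sub>R (x t - z ?s)"])
    fix u assume u: "u \<in> {?s<..<T (Suc k)}"
    then have "u > 0" using T by auto
    have "((\<lambda>t. t\<^sup>2 *\<^sub>R (x t - z ?s)) has_vector_derivative
        (2 * u) *\<^sub>R (x u - z ?s) + u\<^sup>2 *\<^sub>R (2 / u) *\<^sub>R (z u - x u)) (at u)"
      using dx[OF u]
      by (auto intro!: derivative_eq_intros simp: has_real_derivative_iff_has_vector_derivative[symmetric])
    also have "(2 * u) *\<^sub>R (x u - z ?s) + u\<^sup>2 *\<^sub>R (2 / u) *\<^sub>R (z u - x u) = 0"
      using z[OF u] \<open>u > 0\<close> by (simp add: power2_eq_square algebra_simps)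
    finally show "((\<lambda>t. t\<^sup>2 *\<^sub>R (x t - z ?s)) has_vector_derivative 0) (at u)" .
  qed (auto intro!: tendsto_intros cx)
  then have "(1 / t\<^sup>2) *\<^sub>R t\<^sup>2 *\<^sub>R (x t - z ?s) = (1 / t\<^sup>2) *\<^sub>R ?s\<^sup>2 *\<^sub>R (x ?s - z ?s)"
    by simp
  then have "x t - z ?s = (?s / t)\<^sup>2 *\<^sub>R (x ?s - z ?s)"
    using T t by (simp add: power_divide)
  then show ?thesis using z[OF t] by (simp add: algebra_simps)
qed

text \<open>The linear system diagonalizes: \<open>x + z\<close> is conserved, and
  \<open>x - z\<close> decays at rate \<open>2 * \<eta>\<close>.\<close>

lemma continuized_path_flow_strongly_convex:
  fixes x z :: "real \<Rightarrow> 'a::euclidean_space"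
  assumes p: "continuized_path T \<xi> g (\<lambda>t. \<eta>) (\<lambda>t. \<eta>) \<gamma> \<gamma>' x0 z0 x z"
    and T: "0 \<le> T k" and t: "t \<in> {T k<..<T (Suc k)}"
  shows "x t = x (T k) + ((1 - exp (- 2 * \<eta> * (t - T k))) / 2) *\<^sub>R (z (T k) - x (T k)) \<and>
    z t = z (T k) + ((1 - exp (- 2 * \<eta> * (t - T k))) / 2) *\<^sub>R (x (T k) - z (T k))"
proof -
  let ?s = "T k"
  have cx: "(x \<longlongrightarrow> x ?s) (at_right ?s)" and cz: "(z \<longlongrightarrow> z ?s) (at_right ?s)"
    using p T by (auto simp: continuized_path_def cadlag_def)
  have dx: "(x has_vector_derivative \<eta> *\<^sub>R (z u - x u)) (at u)"
    and dz: "(z has_vector_derivative \<eta> *\<^sub>R (x u - z u)) (at u)" if "u \<in> {?s<..<T (Suc k)}" for u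
    using p that by (auto simp: continuized_path_def)
  have sum: "x t + z t = x ?s + z ?s"
  proof (rule zero_derivative_Ioo_eq_limit[OF _ _ t, where q="\<lambda>t. x t + z t"])
    fix u assume u: "u \<in> {?s<..<T (Suc k)}"
    have "((\<lambda>t. x t + z t) has_vector_derivative \<eta> *\<^sub>R (z u - x u) + \<eta> *\<^sub>R (x u - z u)) (at u)"
      using dx[OF u] dz[OF u] by (auto intro!: derivative_eq_intros)
    then show "((\<lambda>t. x t + z t) has_vector_derivative 0) (at u)"
      by (simp add: algebra_simps)
  qed (auto intro!: tendsto_intros cx cz)
  have "exp (2 * \<eta> * (t - ?s)) *\<^sub>R (x t - z t) = exp (2 * \<eta> * (?s - ?s)) *\<^sub>R (x ?s - z ?s)"
  proof (rule zero_derivative_Ioo_eq_limit[OF _ _ t, where q="\<lambda>t. exp (2 * \<eta> * (t - ?s)) *\<^sub>R (x t - z t)"])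
    fix u assume u: "u \<in> {?s<..<T (Suc k)}"
    let ?E = "exp (2 * \<eta> * (u - ?s))"
    have "((\<lambda>t. exp (2 * \<eta> * (t - ?s)) *\<^sub>R (x t - z t)) has_vector_derivative
        ?E *\<^sub>R (\<eta> *\<^sub>R (z u - x u) - \<eta> *\<^sub>R (x u - z u)) + (?E * (2 * \<eta>)) *\<^sub>R (x u - z u)) (at u)"
      using dx[OF u] dz[OF u]
      by (auto intro!: derivative_eq_intros simp: has_real_derivative_iff_has_vector_derivative[symmetric])
    also have "?E *\<^sub>R (\<eta> *\<^sub>R (z u - x u) - \<eta> *\<^sub>R (x u - z u)) + (?E * (2 * \<eta>)) *\<^sub>R (x u - z u)
        = ?E *\<^sub>R (\<eta> *\<^sub>R (z u - x u) - \<eta> *\<^sub>R (x u - z u) + (2 * \<eta>) *\<^sub>R (x u - z u))"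
      by (simp add: scaleR_add_right)
    also have "\<eta> *\<^sub>R (z u - x u) - \<eta> *\<^sub>R (x u - z u) + (2 * \<eta>) *\<^sub>R (x u - z u) = 0"
      by (simp add: algebra_simps scaleR_2[symmetric] mult.commute)
    finally show "((\<lambda>t. exp (2 * \<eta> * (t - ?s)) *\<^sub>R (x t - z t)) has_vector_derivative 0) (at u)"
      by simp
  qed (auto intro!: tendsto_eq_intros cx cz)
  then have "exp (- 2 * \<eta> * (t - ?s)) *\<^sub>R exp (2 * \<eta> * (t - ?s)) *\<^sub>R (x t - z t)
      = exp (- 2 * \<eta> * (t - ?s)) *\<^sub>R (x ?s - z ?s)"
    by simp
  then have diff: "x t - z t = exp (- 2 * \<eta> * (t - ?s)) *\<^sub>R (x ?s - z ?s)"
    by (simp add: exp_add[symmetric])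
  let ?e = "exp (- 2 * \<eta> * (t - ?s))"
  have "x t = (1/2) *\<^sub>R ((x t + z t) + (x t - z t))" "z t = (1/2) *\<^sub>R ((x t + z t) - (x t - z t))"
    by (simp_all add: scaleR_2[symmetric])
  then have 1: "x t = (1/2) *\<^sub>R ((x ?s + z ?s) + ?e *\<^sub>R (x ?s - z ?s))"
    "z t = (1/2) *\<^sub>R ((x ?s + z ?s) - ?e *\<^sub>R (x ?s - z ?s))"
    unfolding sum diff by simp_all
  have 2: "(1/2) *\<^sub>R ((u + v) + e *\<^sub>R (u - v)) = u + ((1 - e) / 2) *\<^sub>R (v - u)"
    "(1/2) *\<^sub>R ((u + v) - e *\<^sub>R (u - v)) = v + ((1 - e) / 2) *\<^sub>R (u - v)" for u v :: 'a and e :: real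
    by (rule euclidean_eqI, simp add: inner_simps field_simps)+
  show ?thesis
    using 1 unfolding 2 by simp
qed

section \<open>The two parameter choices\<close>

text \<open>The budget \<open>t^3 / (12 L^2)\<close> is the primitive of \<open>A / L\<close>
  vanishing at 0, and the flow coefficient \<open>1 - (s / t)^2\<close> is read off from the
  conserved quantity.\<close>

lemma continuized_flow_convex:
  fixes f :: "'a::euclidean_space \<Rightarrow> real"
  assumes "convex_on UNIV f" "\<And>y. f differentiable (at y)" "L > 0" "L_smooth L f"
    "\<And>y. f xs \<le> f y" "prob_space P" "stochastic_gradient f P g \<sigma>"
  shows "continuized_flow f g P L \<sigma> xs (\<lambda>t. t\<^sup>2 / (4 * L)) (\<lambda>t. t / (2 * L)) (\<lambda>t. 1) (\<lambda>t. 0)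
    (\<lambda>t. t ^ 3 / (12 * L\<^sup>2)) (\<lambda>t. 2 / t) (\<lambda>t. 0) (\<lambda>t. t / (2 * L)) (\<lambda>s t. 1 - (s / t)\<^sup>2) (\<lambda>s t. 0)"
proof (rule continuized_flow.intro, goal_cases)
  case (11 s t)
  then show ?case using power_mono[of s t 3] by (intro divide_right_mono) auto
next
  case (21 s t)
  then show ?case
    by (auto intro!: derivative_eq_intros simp: field_simps power2_eq_square)
next
  \<comment> \<open>For \<open>s = 0\<close> the coefficient is constantly 1, also at
    \<open>t = 0\<close> since \<open>0 / 0 = 0\<close>; for \<open>s > 0\<close> the denominator
    stays away from 0.\<close>
  case (23 s)
  show ?case
    by (cases "s = 0") (use 23 in \<open>auto intro!: continuous_intros\<close>)
next
  case (27 t x z)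
  have "t / (2 * L) * (f x - f xs) + t\<^sup>2 / (4 * L) * (2 / t) * inner (gradient f x) (z - x)
      + 0 / 2 * (norm (z - xs))\<^sup>2 + 1 * 0 * inner (x - z) (z - xs)
      - 1 * (t / (2 * L)) * inner (gradient f x) (z - xs)
    = t / (2 * L) * (f x + inner (gradient f x) (xs - x) - f xs)"
    using 27 assms(3) by (simp add: inner_diff_right field_simps power2_eq_square)
  also have "\<dots> \<le> 0"
    using 27 assms(3) convex_gradient_ineq[OF assms(1,2), of x xs]
    by (intro mult_nonneg_nonpos) auto
  finally show ?case .
qed (use assms in \<open>auto intro!: derivative_eq_intros continuous_intros divide_right_mono power_mono
      simp: field_simps power2_eq_square power3_eq_cube\<close>)

lemma continuized_flow_strongly_convex:
  fixes f :: "'a::euclidean_space \<Rightarrow> real"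
  assumes "strongly_convex \<mu> f" "\<mu> > 0" "\<And>y. f differentiable (at y)" "L > 0" "L_smooth L f"
    "\<And>y. f xs \<le> f y" "prob_space P" "stochastic_gradient f P g \<sigma>"
  defines "\<eta> \<equiv> sqrt (\<mu> / L)"
  shows "continuized_flow f g P L \<sigma> xs (\<lambda>t. exp (\<eta> * t)) (\<lambda>t. \<eta> * exp (\<eta> * t))
    (\<lambda>t. \<mu> * exp (\<eta> * t)) (\<lambda>t. \<mu> * \<eta> * exp (\<eta> * t)) (\<lambda>t. exp (\<eta> * t) / (\<eta> * L))
    (\<lambda>t. \<eta>) (\<lambda>t. \<eta>) (\<lambda>t. 1 / sqrt (\<mu> * L))
    (\<lambda>s t. (1 - exp (- 2 * \<eta> * (t - s))) / 2) (\<lambda>s t. (1 - exp (- 2 * \<eta> * (t - s))) / 2)"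
proof -
  have \<eta>: "\<eta> > 0" using assms by simp
  \<comment> \<open>The balance \<open>B \<gamma>' = A \<eta>\<close> that makes the gradient
    products combine to \<open>inner (gradient f x) (xs - x)\<close>.\<close>
  have \<eta>': "\<mu> * (1 / sqrt (\<mu> * L)) = \<eta>"
    using assms(2,4) by (simp add: \<eta>_def real_sqrt_divide real_sqrt_mult real_div_sqrt field_simps)
  show ?thesis
  proof (rule continuized_flow.intro, goal_cases)
    case (10 t)
    then show ?case using assms(2,4) by (simp add: power_divide)
  next
    case (27 t x z)
    let ?E = "exp (\<eta> * t)"
    have sc: "f x + inner (gradient f x) (xs - x) + \<mu> / 2 * (norm (xs - x))\<^sup>2 \<le> f xs"
      using assms(1) by (simp add: strongly_convex_def)
    \<comment> \<open>After strong convexity is used, the quadratic terms of the drift sum to a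
      negative multiple of \<open>|x - z|^2\<close>.\<close>
    have sq: "(norm (xs - x))\<^sup>2 - (norm (z - xs))\<^sup>2 - 2 * inner (x - z) (z - xs) = (norm (x - z))\<^sup>2"
      by (simp add: power2_norm_eq_inner inner_diff inner_commute)
    have "\<eta> * ?E * (f x - f xs) + ?E * \<eta> * inner (gradient f x) (z - x)
        + \<mu> * \<eta> * ?E / 2 * (norm (z - xs))\<^sup>2 + \<mu> * ?E * \<eta> * inner (x - z) (z - xs)
        - \<mu> * ?E * (1 / sqrt (\<mu> * L)) * inner (gradient f x) (z - xs)
      = \<eta> * ?E * (f x - f xs) + ?E * \<eta> * inner (gradient f x) (z - x)
        + \<mu> * \<eta> * ?E / 2 * (norm (z - xs))\<^sup>2 + \<mu> * ?E * \<eta> * inner (x - z) (z - xs)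
        - ?E * (\<mu> * (1 / sqrt (\<mu> * L))) * inner (gradient f x) (z - xs)"
      by simp
    also have "\<dots> = \<eta> * ?E * ((f x + inner (gradient f x) (xs - x) + \<mu> / 2 * (norm (xs - x))\<^sup>2 - f xs)
        - \<mu> / 2 * ((norm (xs - x))\<^sup>2 - (norm (z - xs))\<^sup>2 - 2 * inner (x - z) (z - xs)))"
      unfolding \<eta>' by (simp add: inner_diff_right algebra_simps)
    also have "\<dots> \<le> 0"
      unfolding sq
    proof (rule mult_nonneg_nonpos)
      have "0 \<le> \<mu> / 2 * (norm (x - z))\<^sup>2" using assms(2) by simp
      with sc show "f x + inner (gradient f x) (xs - x) + \<mu> / 2 * (norm (xs - x))\<^sup>2 - f xs
          - \<mu> / 2 * (norm (x - z))\<^sup>2 \<le> 0" by linarith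
    qed (use \<eta> in simp)
    finally show ?case .
  qed (use assms(2-8) \<eta> in \<open>auto intro!: derivative_eq_intros continuous_intros divide_right_mono
      simp: field_simps\<close>)
qed

section \<open>The two convergence bounds\<close>

lemma expectation_bound_convex:
  fixes f :: "'a::euclidean_space \<Rightarrow> real"
  assumes f: "convex_on UNIV f" "\<And>y. f differentiable (at y)" "L > 0" "L_smooth L f"
    "\<And>y. f xs \<le> f y" "prob_space P" "stochastic_gradient f P g \<sigma>"
    and M: "prob_space M" "poisson_atoms M P T \<xi>"
    and proc: "continuized_process M T \<xi> g
      (\<lambda>t. 2 / t) (\<lambda>t. 0) (\<lambda>t. 1 / L) (\<lambda>t. t / (2 * L)) x0 z0 x z"
    and t: "t > 0"
  shows "integrable M (\<lambda>\<omega>. f (x t \<omega>))"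
    and "(\<integral>\<omega>. f (x t \<omega>) \<partial>M) - f xs \<le> 2 * L * (norm (z0 - xs))\<^sup>2 / t\<^sup>2 + \<sigma>\<^sup>2 * (t / (3 * L))"
proof -
  interpret F: continuized_flow f g P L \<sigma> xs "\<lambda>t. t\<^sup>2 / (4 * L)" "\<lambda>t. t / (2 * L)" "\<lambda>t. 1" "\<lambda>t. 0"
    "\<lambda>t. t ^ 3 / (12 * L\<^sup>2)" "\<lambda>t. 2 / t" "\<lambda>t. 0" "\<lambda>t. t / (2 * L)" "\<lambda>s t. 1 - (s / t)\<^sup>2" "\<lambda>s t. 0"
    by (rule continuized_flow_convex) fact+
  have flow: "x u = F.X (T k) u (x (T k)) (z (T k)) \<and> z u = F.Z (T k) u (x (T k)) (z (T k))"
    if "continuized_path T \<xi> g (\<lambda>t. 2 / t) (\<lambda>t. 0) (\<lambda>t. 1 / L) (\<lambda>t. t / (2 * L)) x0 z0 x z"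
      "0 \<le> T k" "u \<in> {T k<..<T (Suc k)}" for T \<xi> x z k u
    unfolding F.X_def F.Z_def using continuized_path_flow_convex[OF that] by simp
  have At: "t\<^sup>2 / (4 * L) > 0" using t f(3) by simp
  note bound = F.expectation_bound[OF M proc _ less_imp_le[OF t] At]
  show "integrable M (\<lambda>\<omega>. f (x t \<omega>))" by (rule bound(1)) (rule flow)
  have "(\<integral>\<omega>. f (x t \<omega>) \<partial>M) - f xs \<le> F.energy t 0 x0 z0 / (t\<^sup>2 / (4 * L))"
    by (rule bound(2)) (rule flow)
  \<comment> \<open>Since \<open>A 0 = 0\<close>, the initial gap \<open>f x0 - f xs\<close> drops
    out; the noise term is \<open>t^3 / (12 L^2)\<close> divided by
    \<open>t^2 / (4 L)\<close>.\<close>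
  also have "\<dots> = 2 * L * (norm (z0 - xs))\<^sup>2 / t\<^sup>2 + \<sigma>\<^sup>2 * (t / (3 * L))"
    unfolding F.energy_def using t f(3) by (simp add: field_simps power2_eq_square power3_eq_cube)
  finally show "(\<integral>\<omega>. f (x t \<omega>) \<partial>M) - f xs \<le> 2 * L * (norm (z0 - xs))\<^sup>2 / t\<^sup>2 + \<sigma>\<^sup>2 * (t / (3 * L))" .
qed

lemma expectation_bound_strongly_convex:
  fixes f :: "'a::euclidean_space \<Rightarrow> real"
  assumes f: "strongly_convex \<mu> f" "\<mu> > 0" "\<And>y. f differentiable (at y)" "L > 0" "L_smooth L f"
    "\<And>y. f xs \<le> f y" "prob_space P" "stochastic_gradient f P g \<sigma>"
    and M: "prob_space M" "poisson_atoms M P T \<xi>"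
    and proc: "continuized_process M T \<xi> g
      (\<lambda>t. sqrt (\<mu> / L)) (\<lambda>t. sqrt (\<mu> / L)) (\<lambda>t. 1 / L) (\<lambda>t. 1 / sqrt (\<mu> * L)) x0 z0 x z"
    and t: "t \<ge> 0"
  shows "integrable M (\<lambda>\<omega>. f (x t \<omega>))"
    and "(\<integral>\<omega>. f (x t \<omega>) \<partial>M) - f xs
      \<le> (f x0 - f xs + \<mu> / 2 * (norm (z0 - xs))\<^sup>2) * exp (- sqrt (\<mu> / L) * t) + \<sigma>\<^sup>2 * (1 / sqrt (\<mu> * L))"
proof -
  define \<eta> where "\<eta> = sqrt (\<mu> / L)"
  interpret F: continuized_flow f g P L \<sigma> xs "\<lambda>t. exp (\<eta> * t)" "\<lambda>t. \<eta> * exp (\<eta> * t)"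
    "\<lambda>t. \<mu> * exp (\<eta> * t)" "\<lambda>t. \<mu> * \<eta> * exp (\<eta> * t)" "\<lambda>t. exp (\<eta> * t) / (\<eta> * L)"
    "\<lambda>t. \<eta>" "\<lambda>t. \<eta>" "\<lambda>t. 1 / sqrt (\<mu> * L)"
    "\<lambda>s t. (1 - exp (- 2 * \<eta> * (t - s))) / 2" "\<lambda>s t. (1 - exp (- 2 * \<eta> * (t - s))) / 2"
    unfolding \<eta>_def by (rule continuized_flow_strongly_convex) fact+
  have flow: "x u = F.X (T k) u (x (T k)) (z (T k)) \<and> z u = F.Z (T k) u (x (T k)) (z (T k))"
    if "continuized_path T \<xi> g (\<lambda>t. \<eta>) (\<lambda>t. \<eta>) (\<lambda>t. 1 / L) (\<lambda>t. 1 / sqrt (\<mu> * L)) x0 z0 x z"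
      "0 \<le> T k" "u \<in> {T k<..<T (Suc k)}" for T \<xi> x z k u
    unfolding F.X_def F.Z_def by (rule continuized_path_flow_strongly_convex[OF that])
  note bound = F.expectation_bound[OF M proc[folded \<eta>_def] _ t exp_gt_zero]
  show "integrable M (\<lambda>\<omega>. f (x t \<omega>))" by (rule bound(1)) (rule flow)
  have \<eta>: "1 / (\<eta> * L) = 1 / sqrt (\<mu> * L)" "\<eta> * L > 0"
    using f(2,4) by (simp_all add: \<eta>_def real_sqrt_divide real_sqrt_mult real_div_sqrt field_simps)
  let ?E = "f x0 - f xs + \<mu> / 2 * (norm (z0 - xs))\<^sup>2"
  have "(\<integral>\<omega>. f (x t \<omega>) \<partial>M) - f xs \<le> F.energy t 0 x0 z0 / exp (\<eta> * t)"
    by (rule bound(2)) (rule flow)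
  also have "\<dots> = ?E * exp (- \<eta> * t) + \<sigma>\<^sup>2 * ((1 - exp (- \<eta> * t)) * (1 / (\<eta> * L)))"
    unfolding F.energy_def using \<eta>(2) f(4) zero_less_mult_pos2[of \<eta> L] by (simp add: exp_minus field_simps)
  \<comment> \<open>The noise collected since time 0 carries the factor
    \<open>1 - exp (- \<eta> * t)\<close>, which is bounded by 1.\<close>
  also have "\<dots> \<le> ?E * exp (- \<eta> * t) + \<sigma>\<^sup>2 * (1 * (1 / (\<eta> * L)))"
    using \<eta>(2) by (intro add_left_mono mult_left_mono mult_right_mono) auto
  finally show "(\<integral>\<omega>. f (x t \<omega>) \<partial>M) - f xs
      \<le> ?E * exp (- sqrt (\<mu> / L) * t) + \<sigma>\<^sup>2 * (1 / sqrt (\<mu> * L))"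
    unfolding \<eta> by (simp add: \<eta>_def)
qed

text \<open>Integrability is part of the conclusion because the Bochner integral of a non-integrable
  function is 0, so the inequality alone would not bound an expectation.\<close>

theorem theorem7:
  fixes f :: "real ^ 'n \<Rightarrow> real"
    and g :: "real ^ 'n \<Rightarrow> 'x \<Rightarrow> real ^ 'n"
    and P :: "'x measure"
    and M :: "'w measure"
    and T :: "nat \<Rightarrow> 'w \<Rightarrow> real"
    and \<xi> :: "nat \<Rightarrow> 'w \<Rightarrow> 'x"
    and x z :: "real \<Rightarrow> 'w \<Rightarrow> real ^ 'n"
    and xs x0 z0 :: "real ^ 'n"
    and L \<sigma> \<mu> :: real
  assumes "convex_on UNIV f"
    and "\<And>y. f differentiable (at y)"
    and "L > 0" and "L_smooth L f"
    and "\<And>y. f xs \<le> f y"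
    and "prob_space P" and "stochastic_gradient f P g \<sigma>"
    and "prob_space M" and "poisson_atoms M P T \<xi>"
  shows "(continuized_process M T \<xi> g
            (\<lambda>t. 2 / t) (\<lambda>t. 0) (\<lambda>t. 1 / L) (\<lambda>t. t / (2 * L)) x0 z0 x z \<longrightarrow>
          (\<forall>t>0. integrable M (\<lambda>\<omega>. f (x t \<omega>)) \<and>
            (\<integral>\<omega>. f (x t \<omega>) \<partial>M) - f xs
              \<le> 2 * L * (norm (z0 - xs))\<^sup>2 / t\<^sup>2 + \<sigma>\<^sup>2 * (t / (3 * L)))) \<and>
         (\<mu> > 0 \<and> strongly_convex \<mu> f \<and>
          continuized_process M T \<xi> g
            (\<lambda>t. sqrt (\<mu> / L)) (\<lambda>t. sqrt (\<mu> / L)) (\<lambda>t. 1 / L) (\<lambda>t. 1 / sqrt (\<mu> * L)) x0 z0 x z \<longrightarrow>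
          (\<forall>t\<ge>0. integrable M (\<lambda>\<omega>. f (x t \<omega>)) \<and>
            (\<integral>\<omega>. f (x t \<omega>) \<partial>M) - f xs
              \<le> (f x0 - f xs + \<mu> / 2 * (norm (z0 - xs))\<^sup>2) * exp (- sqrt (\<mu> / L) * t)
                + \<sigma>\<^sup>2 * (1 / sqrt (\<mu> * L))))"
proof (intro conjI impI allI, goal_cases)
  case (1 t)
  then show ?case by (rule expectation_bound_convex(1)[OF assms])
next
  case (2 t)
  then show ?case by (rule expectation_bound_convex(2)[OF assms])
next
  case (3 t)
  then show ?case using expectation_bound_strongly_convex(1)[OF _ _ assms(2-9)] by blast
next
  case (4 t)
  then show ?case using expectation_bound_strongly_convex(2)[OF _ _ assms(2-9)] by blast
qed

end
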